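(* Let $t>0$ and let $\Gamma$ be a circle in $\mathbb C$ with center at the origin and radius $r(s)=r_0$. The distance in $(M^3_\Gamma,h_t)$ of a point $p_0=\Psi(s_0,\rho_0,\phi_0)\in M^3_\Gamma\cap M^4$ to the curve $\Gamma\subset M^3_\Gamma$ (the zero section) is $$\mathrm{dist}(p_0,\Gamma)=\frac{1}{t\sqrt2}\,\rho_0^2(r_0^2+1)\,\mathcal F\Big(\tfrac12,\tfrac14,\tfrac32,-\tfrac{\rho_0^4(r_0^2+1)^2}{t^4}\Big),$$ where $\mathcal F$ denotes the (Gauss) hypergeometric function.
   Context: Eguchi--Hanson space: $T^*\mathbb P^1(\mathbb C)$ is realized as $H^2=\{(\alpha,\beta,\gamma)\in(\mathbb C^2\setminus\{0\})\times\mathbb C\}/\sim$, where $(\alpha,\beta,\gamma)\sim(A\alpha,A\beta,\gamma/A^2)$ for $A\in\mathbb C^*$; the projection is $p([\alpha,\beta,\gamma])=\alpha/\beta\in\mathbb C\cup\{\infty\}=\mathbb P^1(\mathbb C)$. $M^4\subset H^2$ is the complement of the zero section $\{\gamma=0\}$, identified with $(\mathbb C^2\setminus\{0\})/\{\pm1\}$ by $[\alpha,\beta,\gamma]\mapsto \pm(z_1,z_2)=\pm(\alpha\sqrt\gamma,\beta\sqrt\gamma)$. Put $u_1=|z_1|^2+|z_2|^2$ and $f_t=\sqrt{u_1^2+t^4}+t^2\log\frac{u_1}{\sqrt{u_1^2+t^4}+t^2}$. The form $\omega_t=i\partial\bar\partial f_t$ extends to a Kähler form on $H^2$, and $g_t(X,Y)=\omega_t(X,JY)$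 is the Eguchi--Hanson metric ($J$ the complex structure). Hypersurfaces: for a curve $\Gamma(s)=r(s)e^{i\phi_\Gamma(s)}$ in $\mathbb C$, parametrized by Euclidean arc length, $M^3_\Gamma=p^{-1}(\Gamma)\subset H^2$ with the metric $h_t$ induced by $g_t$. $M^3_\Gamma\cap M^4$ is parametrized by $(s,\rho,\phi)$, $\rho>0$, via $\Psi(s,\rho,\phi)=\pm\rho e^{i\phi}(\Gamma(s),1)$ in the coordinates $\pm(z_1,z_2)$. $\Gamma$ is regarded as the subset $\{[\Gamma(s),1,0]\}$ of $M^3_\Gamma$. $\mathcal F(a,b,c,z)=1+\frac{ab}{c\cdot1}z+\frac{a(a+1)b(b+1)}{c(c+1)\cdot1\cdot2}z^2+\dots$ for $|z|<1$, continued analytically (in particular to the negative real axis). *)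

theory Defs
  imports "HOL-Analysis.Analysis"
begin

section \<open>The space \<open>H\<^sup>2\<close> and its complex charts\<close>

definition EH_carrier :: "(complex \<times> complex \<times> complex) set" where
  "EH_carrier = {(\<alpha>, \<beta>, \<gamma>). (\<alpha>, \<beta>) \<noteq> (0, 0)}"

definition EH_rel ::
    "((complex \<times> complex \<times> complex) \<times> (complex \<times> complex \<times> complex)) set" where
  "EH_rel = {((\<alpha>, \<beta>, \<gamma>), (\<alpha>', \<beta>', \<gamma>')).
     (\<alpha>, \<beta>, \<gamma>) \<in> EH_carrier \<and> (\<alpha>', \<beta>', \<gamma>') \<in> EH_carrier \<and>
     (\<exists>A. A \<noteq> 0 \<and> \<alpha>' = A * \<alpha> \<and> \<beta>' = A * \<beta> \<and> \<gamma>' = \<gamma> / A\<^sup>2)}"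

type_synonym EH_point = "(complex \<times> complex \<times> complex) set"

definition EH_space :: "EH_point set" where
  "EH_space = EH_carrier // EH_rel"

definition EH_class :: "complex \<Rightarrow> complex \<Rightarrow> complex \<Rightarrow> EH_point" where
  "EH_class \<alpha> \<beta> \<gamma> = EH_rel `` {(\<alpha>, \<beta>, \<gamma>)}"

text \<open>
  Functions on \<open>H\<^sup>2\<close> are given on representatives \<open>(\<alpha>, \<beta>, \<gamma>)\<close>; the value at a class \<open>x\<close> is the
  element of the singleton image of \<open>x\<close>.  The Riemann sphere is \<open>complex option\<close>, with \<open>None\<close>
  for the point at infinity.
\<close>

definition EH_proj :: "EH_point \<Rightarrow> complex option" where
  "EH_proj x = the_elem ((\<lambda>(\<alpha>, \<beta>, \<gamma>). if \<beta> = 0 then None else Some (\<alpha> / \<beta>)) ` x)"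

definition EH_zero_section :: "EH_point set" where
  "EH_zero_section = {EH_class \<alpha> \<beta> 0 | \<alpha> \<beta>. (\<alpha>, \<beta>) \<noteq> (0, 0)}"

definition EH_M4 :: "EH_point set" where
  "EH_M4 = EH_space - EH_zero_section"

text \<open>The identification of \<open>M\<^sup>4\<close> with \<open>(\<complex>\<^sup>2 - {0}) / {\<plusminus>1}\<close>, whose elements are the sets \<open>{z, -z}\<close>.\<close>

definition EH_M4_coord :: "EH_point \<Rightarrow> (complex \<times> complex) set" where
  "EH_M4_coord x = the_elem ((\<lambda>(\<alpha>, \<beta>, \<gamma>).
     {(\<alpha> * csqrt \<gamma>, \<beta> * csqrt \<gamma>), - (\<alpha> * csqrt \<gamma>, \<beta> * csqrt \<gamma>)}) ` x)"

text \<open>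
  The charts of the complex surface \<open>H\<^sup>2\<close>, given by their inverses, which are injective on \<open>\<complex>\<^sup>2\<close>;
  their ranges are \<open>{\<beta> \<noteq> 0}\<close> and \<open>{\<alpha> \<noteq> 0}\<close>.  The charts themselves are
  \<open>(\<alpha>/\<beta>, \<gamma>\<beta>\<^sup>2)\<close> and \<open>(\<beta>/\<alpha>, \<gamma>\<alpha>\<^sup>2)\<close>.
\<close>

definition EH_param0 :: "complex ^ 2 \<Rightarrow> EH_point" where
  "EH_param0 q = EH_class (q $ 1) 1 (q $ 2)"

definition EH_param1 :: "complex ^ 2 \<Rightarrow> EH_point" where
  "EH_param1 q = EH_class 1 (q $ 1) (q $ 2)"

definition EH_param_at :: "EH_point \<Rightarrow> (complex ^ 2 \<Rightarrow> EH_point)" where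
  "EH_param_at x = (if x \<in> range EH_param0 then EH_param0 else EH_param1)"

section \<open>The Eguchi--Hanson metric\<close>

definition EH_u1 :: "EH_point \<Rightarrow> real" where
  "EH_u1 x = the_elem ((\<lambda>(z1, z2). (cmod z1)\<^sup>2 + (cmod z2)\<^sup>2) ` EH_M4_coord x)"

definition EH_potential :: "real \<Rightarrow> EH_point \<Rightarrow> real" where
  "EH_potential t x =
     sqrt ((EH_u1 x)\<^sup>2 + t^4) + t\<^sup>2 * ln (EH_u1 x / (sqrt ((EH_u1 x)\<^sup>2 + t^4) + t\<^sup>2))"

text \<open>Wirtinger derivatives: here \<open>axis j 1\<close> is \<open>\<partial>/\<partial>x\<^sub>j\<close> and \<open>axis j \<i>\<close> is \<open>\<partial>/\<partial>y\<^sub>j\<close>.\<close>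

definition wirtinger :: "'n::finite \<Rightarrow> (complex ^ 'n \<Rightarrow> complex) \<Rightarrow> complex ^ 'n \<Rightarrow> complex" where
  "wirtinger j F q =
     (frechet_derivative F (at q) (axis j 1) - \<i> * frechet_derivative F (at q) (axis j \<i>)) / 2"

definition wirtinger_bar :: "'n::finite \<Rightarrow> (complex ^ 'n \<Rightarrow> complex) \<Rightarrow> complex ^ 'n \<Rightarrow> complex" where
  "wirtinger_bar j F q =
     (frechet_derivative F (at q) (axis j 1) + \<i> * frechet_derivative F (at q) (axis j \<i>)) / 2"

text \<open>
  The value of \<open>i \<partial>\<partial>\<^sup>-F\<close> on a pair of tangent vectors, with
  \<open>(dz\<^sub>j \<and> dz\<^sub>k\<^sup>-)(X, Y) = X\<^sub>j Y\<^sub>k\<^sup>- - Y\<^sub>j X\<^sub>k\<^sup>-\<close>.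
\<close>

definition i_ddbar ::
    "(complex ^ 'n \<Rightarrow> complex) \<Rightarrow> complex ^ 'n \<Rightarrow> complex ^ 'n \<Rightarrow> complex ^ 'n \<Rightarrow> complex" where
  "i_ddbar F q X Y =
     \<i> * (\<Sum>j\<in>UNIV. \<Sum>k\<in>UNIV. wirtinger j (wirtinger_bar k F) q *
              (X $ j * cnj (Y $ k) - Y $ j * cnj (X $ k)))"

text \<open>
  The form \<open>\<omega>\<^sub>t\<close> on \<open>H\<^sup>2\<close> in the coordinates of the chart inverse to \<open>\<psi>\<close>: on \<open>M\<^sup>4\<close> it is
  \<open>i \<partial>\<partial>\<^sup>-f\<^sub>t\<close>, on the zero section it is the continuous extension.  Its values are real numbers,
  represented in \<open>complex\<close>.
\<close>

definition EH_form ::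
    "real \<Rightarrow> (complex ^ 2 \<Rightarrow> EH_point) \<Rightarrow> complex ^ 2 \<Rightarrow> complex ^ 2 \<Rightarrow> complex ^ 2 \<Rightarrow> complex" where
  "EH_form t \<psi> q X Y =
     (let \<omega> = (\<lambda>q. i_ddbar (\<lambda>q. complex_of_real (EH_potential t (\<psi> q))) q X Y)
      in if \<psi> q \<in> EH_M4 then \<omega> q else Lim (at q within {q. \<psi> q \<in> EH_M4}) \<omega>)"

definition EH_metric ::
    "real \<Rightarrow> (complex ^ 2 \<Rightarrow> EH_point) \<Rightarrow> complex ^ 2 \<Rightarrow> complex ^ 2 \<Rightarrow> complex ^ 2 \<Rightarrow> real" where
  "EH_metric t \<psi> q X Y = Re (EH_form t \<psi> q X (\<i> *s Y))"

section \<open>Lengths and distances\<close>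

definition C1_on :: "(real \<Rightarrow> 'a::real_normed_vector) \<Rightarrow> real set \<Rightarrow> bool" where
  "C1_on c S \<longleftrightarrow> (\<exists>c'. continuous_on S c' \<and>
     (\<forall>s\<in>S. (c has_vector_derivative c' s) (at s within S)))"

definition EH_C1_curve :: "real \<Rightarrow> real \<Rightarrow> (real \<Rightarrow> EH_point) \<Rightarrow> bool" where
  "EH_C1_curve a b \<sigma> \<longleftrightarrow> (\<forall>s\<in>{a..b}. \<exists>e>0.
     \<sigma> ` ({a..b} \<inter> ball s e) \<subseteq> range (EH_param_at (\<sigma> s)) \<and>
     C1_on (inv (EH_param_at (\<sigma> s)) \<circ> \<sigma>) ({a..b} \<inter> ball s e))"

definition EH_piecewise_C1_curve :: "(real \<Rightarrow> EH_point) \<Rightarrow> bool" where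
  "EH_piecewise_C1_curve \<sigma> \<longleftrightarrow> (\<exists>P. finite P \<and> {0, 1} \<subseteq> P \<and> P \<subseteq> {0..1} \<and>
     (\<forall>a\<in>P. \<forall>b\<in>P. a < b \<and> {a<..<b} \<inter> P = {} \<longrightarrow> EH_C1_curve a b \<sigma>))"

definition EH_speed :: "real \<Rightarrow> (real \<Rightarrow> EH_point) \<Rightarrow> real \<Rightarrow> real" where
  "EH_speed t \<sigma> s =
     (let \<psi> = EH_param_at (\<sigma> s);
          v = vector_derivative (inv \<psi> \<circ> \<sigma>) (at s)
      in sqrt (EH_metric t \<psi> (inv \<psi> (\<sigma> s)) v v))"

text \<open>The finitely many break points, where the two-sided derivative need not exist, are negligible.\<close>

definition EH_length :: "real \<Rightarrow> (real \<Rightarrow> EH_point) \<Rightarrow> real" where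
  "EH_length t \<sigma> = integral {0..1} (EH_speed t \<sigma>)"

text \<open>
  The Riemannian distance in a connected embedded submanifold \<open>N\<close> of \<open>H\<^sup>2\<close> with the metric induced
  by \<open>g\<^sub>t\<close>: the piecewise \<open>C\<^sup>1\<close> curves of \<open>N\<close> are those of \<open>H\<^sup>2\<close> which stay in \<open>N\<close>; their velocities
  are tangent to \<open>N\<close>, and there the induced metric is the restriction of \<open>g\<^sub>t\<close>.
\<close>

definition EH_dist_in :: "real \<Rightarrow> EH_point set \<Rightarrow> EH_point \<Rightarrow> EH_point \<Rightarrow> real" where
  "EH_dist_in t N x y = Inf {EH_length t \<sigma> | \<sigma>. EH_piecewise_C1_curve \<sigma> \<and>
     \<sigma> ` {0..1} \<subseteq> N \<and> \<sigma> 0 = x \<and> \<sigma> 1 = y}"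

definition EH_setdist_in :: "real \<Rightarrow> EH_point set \<Rightarrow> EH_point \<Rightarrow> EH_point set \<Rightarrow> real" where
  "EH_setdist_in t N x A = (INF y\<in>A. EH_dist_in t N x y)"

section \<open>Hypersurfaces over curves\<close>

definition arc_length_param_on :: "(real \<Rightarrow> complex) \<Rightarrow> real set \<Rightarrow> bool" where
  "arc_length_param_on \<Gamma> I \<longleftrightarrow>
     (\<forall>s\<in>I. \<exists>v. (\<Gamma> has_vector_derivative v) (at s within I) \<and> norm v = 1)"

definition EH_M3 :: "complex set \<Rightarrow> EH_point set" where
  "EH_M3 C = {x \<in> EH_space. EH_proj x \<in> Some ` C}"

definition EH_zero_curve :: "complex set \<Rightarrow> EH_point set" where
  "EH_zero_curve C = {EH_class w 1 0 | w. w \<in> C}"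

definition EH_Psi :: "(real \<Rightarrow> complex) \<Rightarrow> real \<Rightarrow> real \<Rightarrow> real \<Rightarrow> EH_point" where
  "EH_Psi \<Gamma> s \<rho> \<phi> =
     (let z = (of_real \<rho> * cis \<phi> * \<Gamma> s, of_real \<rho> * cis \<phi>)
      in the_inv_into EH_M4 EH_M4_coord {z, - z})"

section \<open>The Gauss hypergeometric function\<close>

text \<open>
  The analytic continuation of the hypergeometric series from the unit disc to the plane slit along
  \<open>[1, \<infinity>)\<close>; it is unique on that domain, and the value on the slit is unspecified.
\<close>

definition gauss_hypergeometric :: "complex \<Rightarrow> complex \<Rightarrow> complex \<Rightarrow> complex \<Rightarrow> complex" where
  "gauss_hypergeometric a b c = (SOME h.
     h holomorphic_on (- (complex_of_real ` {1..})) \<and>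
     (\<forall>z\<in>ball 0 1. (\<lambda>n. pochhammer a n * pochhammer b n / (pochhammer c n * fact n) * z ^ n)
        sums h z))"

end

theory Submission
  imports Defs "HOL-Complex_Analysis.Conformal_Mappings"
begin

text \<open>
  In the chart \<open>(w, \<gamma>) \<mapsto> [w, 1, \<gamma>]\<close> put \<open>N = 1 + |w|\<^sup>2\<close> and \<open>S = sqrt (u\<^sub>1\<^sup>2 + t\<^sup>4)\<close> with
  \<open>u\<^sub>1 = |\<gamma>| N\<close>.  Since \<open>u\<^sub>1 df\<^sub>t/du\<^sub>1 = S\<close>, the metric is
  \<open>2 (S |dw|\<^sup>2 / N\<^sup>2 + N\<^sup>2 / (4 S) |d\<gamma> + 2 \<gamma> w\<^sup>- dw / N|\<^sup>2)\<close>.  Over a circle \<open>|w| = r\<close> the form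
  \<open>w\<^sup>- dw\<close> is imaginary, so the length element is at least \<open>N / sqrt (2 S) |d|\<gamma>||\<close>, with equality
  on the radial curves \<open>w = const\<close>, \<open>arg \<gamma> = const\<close>.  The distance is thus the integral of
  \<open>N / sqrt (2 S)\<close> over \<open>|\<gamma>|\<close>, which Euler's integral for the hypergeometric function evaluates.
\<close>

section \<open>Points and charts\<close>

text \<open>Three conventions shape the argument. On the zero section the form is a limit, so the
  Hessian of the potential must be brought into a shape that is continuous there before the metric
  can be read off. The modulus of \<gamma> is not differentiable where it vanishes, so a competing
  curve is measured only up to its first contact with the zero section; the rest contributes a
  nonnegative amount. The hypergeometric function is a choice by \<open>SOME\<close>, so Euler's
  integral has two tasks: it shows that a continuation exists, and the identity theorem then makes
  every continuation equal to it. An unspecified antiderivative \<open>G\<close> of the radial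
  density links the geometry with the special function: lengths are compared with a difference of
  two values of \<open>G\<close>, and only this difference is turned into Euler's integral by a
  rescaling.\<close>

lemma EH_rel_equiv: "equiv EH_carrier EH_rel"
proof (rule equivI)
  show "EH_rel \<subseteq> EH_carrier \<times> EH_carrier"
    by (auto simp: EH_rel_def)
  show "refl_on EH_carrier EH_rel"
    by (rule refl_onI) (auto simp: EH_rel_def intro!: exI[of _ 1])
  show "sym EH_rel"
  proof (rule symI, clarify)
    fix \<alpha> \<beta> \<gamma> \<alpha>' \<beta>' \<gamma>'
    assume *: "((\<alpha>, \<beta>, \<gamma>), (\<alpha>', \<beta>', \<gamma>')) \<in> EH_rel"
    then obtain A where "A \<noteq> 0" "\<alpha>' = A * \<alpha>" "\<beta>' = A * \<beta>" "\<gamma>' = \<gamma> / A\<^sup>2"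
      by (auto simp: EH_rel_def)
    then show "((\<alpha>', \<beta>', \<gamma>'), (\<alpha>, \<beta>, \<gamma>)) \<in> EH_rel"
      using * by (auto simp: EH_rel_def field_simps intro!: exI[of _ "inverse A"])
  qed
  show "trans EH_rel"
  proof (rule transI, clarify)
    fix \<alpha> \<beta> \<gamma> \<alpha>' \<beta>' \<gamma>' \<alpha>'' \<beta>'' \<gamma>''
    assume *: "((\<alpha>, \<beta>, \<gamma>), (\<alpha>', \<beta>', \<gamma>')) \<in> EH_rel"
      "((\<alpha>', \<beta>', \<gamma>'), (\<alpha>'', \<beta>'', \<gamma>'')) \<in> EH_rel"
    then obtain A B where "A \<noteq> 0" "\<alpha>' = A * \<alpha>" "\<beta>' = A * \<beta>" "\<gamma>' = \<gamma> / A\<^sup>2"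
      "B \<noteq> 0" "\<alpha>'' = B * \<alpha>'" "\<beta>'' = B * \<beta>'" "\<gamma>'' = \<gamma>' / B\<^sup>2"
      by (auto simp: EH_rel_def)
    then show "((\<alpha>, \<beta>, \<gamma>), (\<alpha>'', \<beta>'', \<gamma>'')) \<in> EH_rel"
      using * by (auto simp: EH_rel_def field_simps intro!: exI[of _ "B * A"])
  qed
qed

lemma EH_class_eq:
  assumes "(\<alpha>, \<beta>) \<noteq> (0, 0)"
  shows "EH_class \<alpha> \<beta> \<gamma> = {(A * \<alpha>, A * \<beta>, \<gamma> / A\<^sup>2) | A. A \<noteq> 0}"
  using assms by (auto simp: EH_class_def EH_rel_def EH_carrier_def)

lemma EH_class_in_space: "(\<alpha>, \<beta>) \<noteq> (0, 0) \<Longrightarrow> EH_class \<alpha> \<beta> \<gamma> \<in> EH_space"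
  unfolding EH_class_def EH_space_def by (rule quotientI) (auto simp: EH_carrier_def)

lemma EH_space_cases:
  assumes "x \<in> EH_space"
  obtains \<alpha> \<beta> \<gamma> where "(\<alpha>, \<beta>) \<noteq> (0, 0)" "x = EH_class \<alpha> \<beta> \<gamma>"
  using assms unfolding EH_space_def
  by (elim quotientE) (auto simp: EH_class_def EH_carrier_def)

lemma EH_class_scale:
  assumes "(\<alpha>, \<beta>) \<noteq> (0, 0)" "A \<noteq> 0"
  shows "EH_class (A * \<alpha>) (A * \<beta>) (\<gamma> / A\<^sup>2) = EH_class \<alpha> \<beta> \<gamma>"
  unfolding EH_class_def
  by (rule equiv_class_eq[OF EH_rel_equiv, symmetric])
     (use assms in \<open>auto simp: EH_rel_def EH_carrier_def\<close>)

lemma the_elem_image_const: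
  assumes "a \<in> X" "\<And>x. x \<in> X \<Longrightarrow> f x = c"
  shows "the_elem (f ` X) = c"
proof -
  have "f ` X = {c}" using assms by auto
  then show ?thesis by simp
qed

lemma EH_class_self: "(\<alpha>, \<beta>) \<noteq> (0, 0) \<Longrightarrow> (\<alpha>, \<beta>, \<gamma>) \<in> EH_class \<alpha> \<beta> \<gamma>"
  by (auto simp: EH_class_eq intro!: exI[of _ 1])

lemma EH_proj_class:
  assumes "(\<alpha>, \<beta>) \<noteq> (0, 0)"
  shows "EH_proj (EH_class \<alpha> \<beta> \<gamma>) = (if \<beta> = 0 then None else Some (\<alpha> / \<beta>))"
  unfolding EH_proj_def
  by (rule the_elem_image_const, rule EH_class_self[OF assms]) (auto simp: EH_class_eq[OF assms])

text \<open>The branch cut of \<open>csqrt\<close> may flip the sign when the representative of a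
  class is rescaled. The pair of opposite points in \<open>EH_M4_coord\<close> absorbs exactly this
  ambiguity.\<close>

lemma csqrt_divide_square_cases:
  assumes "A \<noteq> 0"
  shows "A * csqrt (\<gamma> / A\<^sup>2) = csqrt \<gamma> \<or> A * csqrt (\<gamma> / A\<^sup>2) = - csqrt \<gamma>"
proof -
  have "(A * csqrt (\<gamma> / A\<^sup>2))\<^sup>2 = (csqrt \<gamma>)\<^sup>2"
    using assms by (simp add: power_mult_distrib)
  then show ?thesis by (simp only: power2_eq_iff)
qed

lemma EH_M4_coord_class:
  assumes "(\<alpha>, \<beta>) \<noteq> (0, 0)"
  shows "EH_M4_coord (EH_class \<alpha> \<beta> \<gamma>) =
    {(\<alpha> * csqrt \<gamma>, \<beta> * csqrt \<gamma>), - (\<alpha> * csqrt \<gamma>, \<beta> * csqrt \<gamma>)}"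
  unfolding EH_M4_coord_def
proof (rule the_elem_image_const, rule EH_class_self[OF assms])
  fix x assume "x \<in> EH_class \<alpha> \<beta> \<gamma>"
  then obtain A where A: "A \<noteq> 0" and x: "x = (A * \<alpha>, A * \<beta>, \<gamma> / A\<^sup>2)"
    by (auto simp: EH_class_eq[OF assms])
  have *: "A * \<alpha> * c = \<alpha> * (A * c)" "A * \<beta> * c = \<beta> * (A * c)" for c
    by (simp_all add: mult_ac)
  show "(case x of (\<alpha>, \<beta>, \<gamma>) \<Rightarrow>
      {(\<alpha> * csqrt \<gamma>, \<beta> * csqrt \<gamma>), - (\<alpha> * csqrt \<gamma>, \<beta> * csqrt \<gamma>)}) =
    {(\<alpha> * csqrt \<gamma>, \<beta> * csqrt \<gamma>), - (\<alpha> * csqrt \<gamma>, \<beta> * csqrt \<gamma>)}"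
    using csqrt_divide_square_cases[OF A, of \<gamma>] unfolding x prod.case * by auto
qed

lemma EH_class_eq_zero_section_iff:
  assumes "(\<alpha>, \<beta>) \<noteq> (0, 0)"
  shows "EH_class \<alpha> \<beta> \<gamma> \<in> EH_zero_section \<longleftrightarrow> \<gamma> = 0"
proof
  assume "EH_class \<alpha> \<beta> \<gamma> \<in> EH_zero_section"
  then obtain \<alpha>' \<beta>' where "(\<alpha>', \<beta>') \<noteq> (0, 0)" "EH_class \<alpha> \<beta> \<gamma> = EH_class \<alpha>' \<beta>' 0"
    by (auto simp: EH_zero_section_def)
  with EH_class_self[OF assms, of \<gamma>] show "\<gamma> = 0"
    by (auto simp: EH_class_eq)
qed (use assms in \<open>auto simp: EH_zero_section_def\<close>)

lemma EH_class_in_M4_iff: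
  "(\<alpha>, \<beta>) \<noteq> (0, 0) \<Longrightarrow> EH_class \<alpha> \<beta> \<gamma> \<in> EH_M4 \<longleftrightarrow> \<gamma> \<noteq> 0"
  by (simp add: EH_M4_def EH_class_in_space EH_class_eq_zero_section_iff)

text \<open>This gives \<open>the_inv_into\<close> in \<open>EH_Psi\<close> its meaning.\<close>

lemma EH_M4_coord_inj: "inj_on EH_M4_coord EH_M4"
proof (rule inj_onI)
  fix x y assume xy: "x \<in> EH_M4" "y \<in> EH_M4" and eq: "EH_M4_coord x = EH_M4_coord y"
  obtain \<alpha> \<beta> \<gamma> where ab: "(\<alpha>, \<beta>) \<noteq> (0, 0)" and x: "x = EH_class \<alpha> \<beta> \<gamma>"
    using xy by (metis Diff_iff EH_M4_def EH_space_cases)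
  obtain \<alpha>' \<beta>' \<gamma>' where ab': "(\<alpha>', \<beta>') \<noteq> (0, 0)" and y: "y = EH_class \<alpha>' \<beta>' \<gamma>'"
    using xy by (metis Diff_iff EH_M4_def EH_space_cases)
  have nz: "\<gamma> \<noteq> 0" "\<gamma>' \<noteq> 0"
    using xy ab ab' by (simp_all add: x y EH_class_in_M4_iff)
  have "(\<alpha>' * csqrt \<gamma>', \<beta>' * csqrt \<gamma>') \<in> EH_M4_coord x"
    unfolding eq y EH_M4_coord_class[OF ab'] by simp
  then obtain e where e: "e\<^sup>2 = 1" "\<alpha>' * csqrt \<gamma>' = e * (\<alpha> * csqrt \<gamma>)"
    "\<beta>' * csqrt \<gamma>' = e * (\<beta> * csqrt \<gamma>)"
  proof -
    assume *: "\<And>e. e\<^sup>2 = 1 \<Longrightarrow> \<alpha>' * csqrt \<gamma>' = e * (\<alpha> * csqrt \<gamma>) \<Longrightarrow>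
      \<beta>' * csqrt \<gamma>' = e * (\<beta> * csqrt \<gamma>) \<Longrightarrow> thesis"
    assume "(\<alpha>' * csqrt \<gamma>', \<beta>' * csqrt \<gamma>') \<in> EH_M4_coord x"
    then show thesis
      using *[of 1] *[of "-1"] by (auto simp: x EH_M4_coord_class[OF ab])
  qed
  \<comment> \<open>Dividing the two equations in \<open>e(2,3)\<close> by
    \<open>csqrt \<gamma>'\<close> shows that this factor carries the first representative to the
    second; the sign \<open>e\<close> disappears in its square.\<close>
  define A where "A = e * csqrt \<gamma> / csqrt \<gamma>'"
  have A: "A \<noteq> 0" "A\<^sup>2 = \<gamma> / \<gamma>'"
    using nz e(1) by (auto simp: A_def power_mult_distrib power_divide)
  have "\<alpha>' = A * \<alpha>" "\<beta>' = A * \<beta>" "\<gamma>' = \<gamma> / A\<^sup>2"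
    using nz e(2,3) unfolding A(2) by (auto simp: A_def field_simps)
  then show "x = y"
    unfolding x y using EH_class_scale[OF ab A(1)] by simp
qed

lemma EH_Psi_eq:
  assumes "\<rho> > 0"
  shows "EH_Psi \<Gamma> s \<rho> \<phi> = EH_class (\<Gamma> s) 1 ((of_real \<rho> * cis \<phi>)\<^sup>2)"
proof -
  define c where "c = of_real \<rho> * cis \<phi>"
  have c: "c \<noteq> 0" using assms by (simp add: c_def)
  \<comment> \<open>The representative with third entry 1 has \<open>csqrt 1 = 1\<close>, so its
    coordinates can be read off without choosing a branch.\<close>
  have "EH_class (\<Gamma> s) 1 (c\<^sup>2) = EH_class (c * \<Gamma> s) c 1"
    using EH_class_scale[of "\<Gamma> s" 1 c "c\<^sup>2"] c by simp
  then have "EH_M4_coord (EH_class (\<Gamma> s) 1 (c\<^sup>2)) = {(c * \<Gamma> s, c), - (c * \<Gamma> s, c)}"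
    using EH_M4_coord_class[of "c * \<Gamma> s" c 1] c by simp
  moreover have "EH_class (\<Gamma> s) 1 (c\<^sup>2) \<in> EH_M4"
    using c by (simp add: EH_class_in_M4_iff)
  ultimately show ?thesis
    unfolding EH_Psi_def Let_def c_def[symmetric]
    using the_inv_into_f_f[OF EH_M4_coord_inj] by metis
qed

lemma EH_param0_inj: "inj EH_param0"
proof (rule injI)
  fix p q :: "complex ^ 2"
  assume *: "EH_param0 p = EH_param0 q"
  have "(p $ 1, 1, p $ 2) \<in> EH_param0 q"
    unfolding *[symmetric] unfolding EH_param0_def by (rule EH_class_self) simp
  then show "p = q"
    by (auto simp: EH_param0_def EH_class_eq vec_eq_iff forall_2)
qed

lemma inv_EH_param0 [simp]: "inv EH_param0 (EH_param0 q) = q"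
  by (rule inv_f_f[OF EH_param0_inj])

lemma EH_param0_in_M4_iff: "EH_param0 q \<in> EH_M4 \<longleftrightarrow> q $ 2 \<noteq> 0"
  by (simp add: EH_param0_def EH_class_in_M4_iff)

text \<open>A base curve in the finite plane avoids the fibre over infinity, so the hypersurface,
  zero section included, lies in the range of a single chart.\<close>

lemma EH_M3_eq: "EH_M3 C = {EH_param0 q | q. q $ 1 \<in> C}"
proof (intro equalityI subsetI)
  fix x assume x: "x \<in> EH_M3 C"
  then obtain \<alpha> \<beta> \<gamma> where ab: "(\<alpha>, \<beta>) \<noteq> (0, 0)" and xe: "x = EH_class \<alpha> \<beta> \<gamma>"
    unfolding EH_M3_def by (metis (no_types, lifting) EH_space_cases mem_Collect_eq)
  have b: "\<beta> \<noteq> 0" and C: "\<alpha> / \<beta> \<in> C"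
    using x by (auto simp: EH_M3_def xe EH_proj_class[OF ab] split: if_splits)
  have "x = EH_param0 (vector [\<alpha> / \<beta>, \<gamma> * \<beta>\<^sup>2])"
    using EH_class_scale[of "\<alpha> / \<beta>" 1 \<beta> "\<gamma> * \<beta>\<^sup>2"] b by (simp add: xe EH_param0_def)
  then show "x \<in> {EH_param0 q | q. q $ 1 \<in> C}"
    using C by (auto intro!: exI[of _ "vector [\<alpha> / \<beta>, \<gamma> * \<beta>\<^sup>2]"])
qed (auto simp: EH_M3_def EH_param0_def EH_class_in_space EH_proj_class)

lemma EH_u1_param0: "EH_u1 (EH_param0 q) = cmod (q $ 2) * (1 + (cmod (q $ 1))\<^sup>2)"
proof -
  let ?z = "(q $ 1 * csqrt (q $ 2), csqrt (q $ 2))"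
  have "(cmod (csqrt (q $ 2)))\<^sup>2 = cmod (q $ 2)"
    by (metis norm_power power2_csqrt)
  then have "(cmod (q $ 1 * csqrt (q $ 2)))\<^sup>2 + (cmod (csqrt (q $ 2)))\<^sup>2
      = cmod (q $ 2) * (1 + (cmod (q $ 1))\<^sup>2)"
    by (simp add: norm_mult power_mult_distrib algebra_simps)
  moreover have "EH_M4_coord (EH_param0 q) = {?z, - ?z}"
    using EH_M4_coord_class[of "q $ 1" 1 "q $ 2"] by (simp add: EH_param0_def)
  ultimately show ?thesis
    unfolding EH_u1_def by (intro the_elem_image_const[of ?z]) auto
qed

section \<open>The metric in a chart\<close>

definition EH_N :: "complex ^ 2 \<Rightarrow> real" where
  "EH_N q = 1 + (cmod (q $ 1))\<^sup>2"

definition EH_S :: "real \<Rightarrow> complex ^ 2 \<Rightarrow> real" where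
  "EH_S t q = sqrt ((cmod (q $ 2) * EH_N q)\<^sup>2 + t ^ 4)"

text \<open>The differential of \<open>ln u\<^sub>1\<close> in the chart.\<close>

definition EH_dlog :: "complex ^ 2 \<Rightarrow> complex ^ 2 \<Rightarrow> real" where
  "EH_dlog q h = Re (h $ 2 / q $ 2) + 2 * Re (cnj (q $ 1) * h $ 1) / EH_N q"

lemma EH_N_pos [simp]: "EH_N q > 0"
  by (simp add: EH_N_def add_pos_nonneg)

lemma EH_N_nonzero [simp]: "EH_N q \<noteq> 0"
  using EH_N_pos[of q] by linarith

lemma EH_S_pos: "t > 0 \<Longrightarrow> EH_S t q > 0"
  by (simp add: EH_S_def add_nonneg_pos)

lemma has_derivative_vec_nth:
  "((\<lambda>q::complex ^ 'n. q $ i) has_derivative (\<lambda>h. h $ i)) (at q)"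
  by (intro bounded_linear_imp_has_derivative bounded_linear_vec_nth)

lemma EH_N_deriv: "(EH_N has_derivative (\<lambda>h. 2 * Re (cnj (q $ 1) * h $ 1))) (at q)"
  unfolding EH_N_def cmod_power2
  by (auto intro!: derivative_eq_intros has_derivative_vec_nth simp: algebra_simps)

lemma EH_u1_deriv:
  assumes "q $ 2 \<noteq> 0"
  shows "((\<lambda>q. cmod (q $ 2) * EH_N q) has_derivative
    (\<lambda>h. cmod (q $ 2) * EH_N q * EH_dlog q h)) (at q)"
proof -
  have "((\<lambda>q. cmod (q $ 2)) has_derivative (\<lambda>h. h $ 2 \<bullet> sgn (q $ 2))) (at q)"
    by (rule has_derivative_compose[OF has_derivative_vec_nth has_derivative_norm[OF assms]])
  moreover have "h $ 2 \<bullet> sgn (q $ 2) = cmod (q $ 2) * Re (h $ 2 / q $ 2)" for h :: "complex ^ 2"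
    using assms
    by (simp add: inner_complex_def sgn_eq Re_divide Re_divide_of_real Im_divide_of_real
        flip: cmod_power2) (simp add: power2_eq_square field_simps)
  ultimately have "((\<lambda>q. cmod (q $ 2)) has_derivative
      (\<lambda>h. cmod (q $ 2) * Re (h $ 2 / q $ 2))) (at q)"
    by simp
  from has_derivative_mult[OF this EH_N_deriv] show ?thesis
    by (rule has_derivative_eq_rhs) (simp add: fun_eq_iff EH_dlog_def field_simps)
qed

lemma EH_S_deriv:
  assumes "t > 0" "q $ 2 \<noteq> 0"
  shows "(EH_S t has_derivative
    (\<lambda>h. (cmod (q $ 2) * EH_N q)\<^sup>2 / EH_S t q * EH_dlog q h)) (at q)"
proof -
  have "(cmod (q $ 2) * EH_N q)\<^sup>2 + t ^ 4 > 0"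
    using assms by (simp add: add_nonneg_pos)
  then have "((\<lambda>u. sqrt (u\<^sup>2 + t ^ 4)) has_real_derivative (cmod (q $ 2) * EH_N q) / EH_S t q)
      (at (cmod (q $ 2) * EH_N q))"
    unfolding EH_S_def by (auto intro!: derivative_eq_intros simp: field_simps)
  from DERIV_compose_FDERIV[OF this EH_u1_deriv[OF assms(2)]] show ?thesis
    by (simp add: EH_S_def[abs_def] power2_eq_square mult_ac)
qed

lemma EH_potential_deriv_u:
  fixes t u :: real
  assumes "t > 0" "u > 0"
  shows "((\<lambda>u. sqrt (u\<^sup>2 + t ^ 4) + t\<^sup>2 * ln (u / (sqrt (u\<^sup>2 + t ^ 4) + t\<^sup>2)))
    has_field_derivative sqrt (u\<^sup>2 + t ^ 4) / u) (at u)"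
proof -
  define S where "S = sqrt (u\<^sup>2 + t ^ 4)"
  have pos: "u\<^sup>2 + t ^ 4 > 0" using assms by (simp add: add_nonneg_pos)
  have S: "S > 0" "S + t\<^sup>2 > 0" using pos assms by (simp_all add: S_def add_pos_pos)
  have S2: "S\<^sup>2 = u\<^sup>2 + t ^ 4" using pos by (simp add: S_def)
  have "((\<lambda>u. sqrt (u\<^sup>2 + t ^ 4) + t\<^sup>2 * ln (u / (sqrt (u\<^sup>2 + t ^ 4) + t\<^sup>2)))
    has_field_derivative
      u / S + t\<^sup>2 * (1 / u - u / (S * (S + t\<^sup>2)))) (at u)"
  proof -
    have dS: "((\<lambda>u. sqrt (u\<^sup>2 + t ^ 4)) has_field_derivative u / S) (at u)"
      using pos unfolding S_def by (auto intro!: derivative_eq_intros simp: field_simps)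
    have "((\<lambda>u. u / (sqrt (u\<^sup>2 + t ^ 4) + t\<^sup>2)) has_field_derivative
        (1 * (S + t\<^sup>2) - u * (u / S + 0)) / ((S + t\<^sup>2) * (S + t\<^sup>2))) (at u)"
      using S unfolding S_def by (intro DERIV_divide DERIV_add dS[unfolded S_def] DERIV_const DERIV_ident) auto
    moreover have "u / (S + t\<^sup>2) > 0" using S assms by simp
    ultimately have "((\<lambda>u. ln (u / (sqrt (u\<^sup>2 + t ^ 4) + t\<^sup>2))) has_field_derivative
        1 / (u / (S + t\<^sup>2)) * ((1 * (S + t\<^sup>2) - u * (u / S + 0)) / ((S + t\<^sup>2) * (S + t\<^sup>2)))) (at u)"
      unfolding S_def by (intro DERIV_chain2[OF DERIV_ln_divide]) auto
    moreover have "1 / (u / c) * ((1 * c - u * (u / S + 0)) / (c * c)) = 1 / u - u / (S * c)"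
      if "c > 0" for c
      using S(1) assms(2) that by (simp add: field_simps)
    ultimately have "((\<lambda>u. ln (u / (sqrt (u\<^sup>2 + t ^ 4) + t\<^sup>2))) has_field_derivative
        1 / u - u / (S * (S + t\<^sup>2))) (at u)"
      using S(2) by simp
    from DERIV_add[OF dS DERIV_cmult[OF this]] show ?thesis .
  qed
  moreover have "u / S + t\<^sup>2 * (1 / u - u / (S * (S + t\<^sup>2))) = S / u"
  proof -
    \<comment> \<open>Rationalizing with (S - t^2)(S + t^2) = u^2 removes the sum from the
      denominator.\<close>
    have "u / (S * (S + t\<^sup>2)) = (S - t\<^sup>2) / (S * u)"
    proof -
      have "(S - t\<^sup>2) * (S + t\<^sup>2) = u\<^sup>2"
        using S2 by (simp add: algebra_simps power2_eq_square power4_eq_xxxx)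
      then have "u * (S * u) = (S - t\<^sup>2) * (S * (S + t\<^sup>2))"
        by (simp add: power2_eq_square mult_ac)
      then show ?thesis using S assms by (subst frac_eq_eq) auto
    qed
    moreover have "u / S + t\<^sup>2 * (1 / u - (S - t\<^sup>2) / (S * u)) = (u\<^sup>2 + t ^ 4) / (S * u)"
      using S assms by (simp add: field_simps power2_eq_square power4_eq_xxxx)
    moreover have "\<dots> = S / u"
      using S assms unfolding S2[symmetric] by (simp add: power2_eq_square)
    ultimately show ?thesis by simp
  qed
  ultimately show ?thesis by (simp add: S_def)
qed

lemma EH_potential_deriv:
  assumes "t > 0" "q $ 2 \<noteq> 0"
  shows "((\<lambda>q. complex_of_real (EH_potential t (EH_param0 q))) has_derivative
    (\<lambda>h. of_real (EH_S t q * EH_dlog q h))) (at q)"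
proof -
  have u: "cmod (q $ 2) * EH_N q > 0" using assms by simp
  have eq: "EH_potential t (EH_param0 q) =
      (\<lambda>u. sqrt (u\<^sup>2 + t ^ 4) + t\<^sup>2 * ln (u / (sqrt (u\<^sup>2 + t ^ 4) + t\<^sup>2)))
        (cmod (q $ 2) * EH_N q)" for q
    by (simp add: EH_potential_def EH_u1_param0 EH_N_def)
  have "((\<lambda>q. EH_potential t (EH_param0 q)) has_derivative
      (\<lambda>h. EH_S t q / (cmod (q $ 2) * EH_N q) * (cmod (q $ 2) * EH_N q * EH_dlog q h))) (at q)"
    unfolding eq EH_S_def
    using DERIV_compose_FDERIV[OF EH_potential_deriv_u[OF assms(1) u] EH_u1_deriv[OF assms(2)]]
    by (simp add: mult_ac)
  then have "((\<lambda>q. EH_potential t (EH_param0 q)) has_derivative (\<lambda>h. EH_S t q * EH_dlog q h)) (at q)"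
    using assms by simp
  then show ?thesis by (rule has_derivative_of_real)
qed

section \<open>The complex Hessian of the potential off the zero section\<close>

lemma axis_simps [simp]:
  "axis (1::2) x $ 1 = x" "axis (1::2) x $ 2 = 0" "axis (2::2) x $ 1 = 0" "axis (2::2) x $ 2 = x"
  by (simp_all add: axis_def)

lemma EH_dlog_axis:
  "EH_dlog q (axis 1 x) = Re (2 * cnj (q $ 1) / of_real (EH_N q) * x)"
  "EH_dlog q (axis 2 x) = Re (1 / q $ 2 * x)"
  by (simp_all add: EH_dlog_def Re_divide_of_real Im_divide_of_real field_simps)

text \<open>The real functional Re (a x) splits into a complex linear and an antilinear half with
  coefficients a/2 and \<open>cnj a\<close>/2; up to the factor 1/2 the two combinations are the
  Wirtinger operators.\<close>

lemma complex_linear_part: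
  "complex_of_real (Re (a * 1)) - \<i> * of_real (Re (a * \<i>)) = a"
  "complex_of_real (Re (a * 1)) + \<i> * of_real (Re (a * \<i>)) = cnj a"
  by (simp_all add: complex_eq_iff)

text \<open>The potential depends on u1 alone, so its antiholomorphic derivative is S times that of
  ln u1. The logarithm splits into ln N and the logarithm of the modulus of \<gamma>, which give the
  two components.\<close>

lemma wirtinger_bar_potential:
  assumes "t > 0" "q $ 2 \<noteq> 0"
  shows "wirtinger_bar 1 (\<lambda>q. complex_of_real (EH_potential t (EH_param0 q))) q =
      of_real (EH_S t q) * q $ 1 / of_real (EH_N q)"
    and "wirtinger_bar 2 (\<lambda>q. complex_of_real (EH_potential t (EH_param0 q))) q =
      of_real (EH_S t q) / (2 * cnj (q $ 2))"
proof -
  have *: "of_real (s * x) + \<i> * of_real (s * y) = of_real s * (of_real x + \<i> * of_real y)" for s x y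
    by (simp add: algebra_simps)
  show "wirtinger_bar 1 (\<lambda>q. complex_of_real (EH_potential t (EH_param0 q))) q =
      of_real (EH_S t q) * q $ 1 / of_real (EH_N q)"
    "wirtinger_bar 2 (\<lambda>q. complex_of_real (EH_potential t (EH_param0 q))) q =
      of_real (EH_S t q) / (2 * cnj (q $ 2))"
    unfolding wirtinger_bar_def frechet_derivative_at[OF EH_potential_deriv[OF assms], symmetric]
      * EH_dlog_axis complex_linear_part by simp_all
qed

lemma wirtinger_eq:
  assumes "(f has_derivative f') (at q)"
  shows "wirtinger j f q = (f' (axis j 1) - \<i> * f' (axis j \<i>)) / 2"
  unfolding wirtinger_def frechet_derivative_at[OF assms, symmetric] ..

text \<open>The first derivatives of the potential are known only off the zero section. That set is
  open, so agreement there determines the second derivatives.\<close>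

lemma wirtinger_cong_M4:
  fixes f g :: "complex ^ 2 \<Rightarrow> complex" and q :: "complex ^ 2"
  assumes "(f has_derivative f') (at q)" "q $ 2 \<noteq> 0" "\<And>q. q $ 2 \<noteq> 0 \<Longrightarrow> f q = g q"
  shows "wirtinger j g q = (f' (axis j 1) - \<i> * f' (axis j \<i>)) / 2"
proof (rule wirtinger_eq, rule has_derivative_transform_within_open[OF assms(1)])
  show "open {q :: complex ^ 2. q $ 2 \<noteq> 0}"
    by (intro open_Collect_neq continuous_intros)
qed (use assms in auto)

text \<open>The matrix of \<open>\<partial>\<partial>\<^sup>-f\<^sub>t\<close>, in a form which is continuous across the zero section.\<close>

definition EH_hess :: "real \<Rightarrow> complex ^ 2 \<Rightarrow> 2 \<Rightarrow> 2 \<Rightarrow> complex" where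
  "EH_hess t q j k =
     (if j = 1 then
        if k = 1 then of_real ((cmod (q $ 2))\<^sup>2 * (cmod (q $ 1))\<^sup>2 / EH_S t q + EH_S t q / (EH_N q)\<^sup>2)
        else cnj (q $ 1) * q $ 2 * of_real (EH_N q / (2 * EH_S t q))
      else
        if k = 1 then q $ 1 * cnj (q $ 2) * of_real (EH_N q / (2 * EH_S t q))
        else of_real ((EH_N q)\<^sup>2 / (4 * EH_S t q)))"

lemma EH_dbar_deriv1:
  assumes "t > 0" "q $ 2 \<noteq> 0"
  shows "((\<lambda>q. of_real (EH_S t q) * q $ 1 / of_real (EH_N q)) has_derivative
    (\<lambda>h. of_real ((cmod (q $ 2) * EH_N q)\<^sup>2 / EH_S t q * EH_dlog q h) * (q $ 1 / of_real (EH_N q)) +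
         of_real (EH_S t q) * (h $ 1 / of_real (EH_N q) -
           q $ 1 * of_real (2 * Re (cnj (q $ 1) * h $ 1)) / (of_real (EH_N q))\<^sup>2))) (at q)"
proof -
  have "((\<lambda>q. of_real (EH_S t q) * q $ 1 / of_real (EH_N q)) has_derivative
    (\<lambda>h. (- (of_real (EH_S t q) * q $ 1) *
      (inverse (of_real (EH_N q)) * of_real (2 * Re (cnj (q $ 1) * h $ 1)) * inverse (of_real (EH_N q))) +
      (of_real (EH_S t q) * h $ 1 +
       of_real ((cmod (q $ 2) * EH_N q)\<^sup>2 / EH_S t q * EH_dlog q h) * q $ 1) / of_real (EH_N q)))) (at q)"
    by (intro has_derivative_divide has_derivative_mult has_derivative_of_real EH_S_deriv EH_N_deriv assms
        has_derivative_vec_nth) simp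
  then show ?thesis
    by (rule back_subst[where P = "\<lambda>f. (_ has_derivative f) _"])
       (simp add: fun_eq_iff field_simps power2_eq_square)
qed

lemma EH_dbar_deriv2:
  assumes "t > 0" "q $ 2 \<noteq> 0"
  shows "((\<lambda>q. of_real (EH_S t q) / (2 * cnj (q $ 2))) has_derivative
    (\<lambda>h. of_real ((cmod (q $ 2) * EH_N q)\<^sup>2 / EH_S t q * EH_dlog q h) / (2 * cnj (q $ 2)) -
         of_real (EH_S t q) * cnj (h $ 2) / (2 * (cnj (q $ 2))\<^sup>2))) (at q)"
proof -
  have "((\<lambda>q. of_real (EH_S t q) / (2 * cnj (q $ 2))) has_derivative
    (\<lambda>h. - of_real (EH_S t q) *
      (inverse (2 * cnj (q $ 2)) * (2 * cnj (h $ 2)) * inverse (2 * cnj (q $ 2))) +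
      of_real ((cmod (q $ 2) * EH_N q)\<^sup>2 / EH_S t q * EH_dlog q h) / (2 * cnj (q $ 2)))) (at q)"
    by (intro has_derivative_divide has_derivative_mult_right has_derivative_of_real EH_S_deriv assms
        has_derivative_cnj has_derivative_vec_nth) (use assms in simp)
  then show ?thesis
    by (rule back_subst[where P = "\<lambda>f. (_ has_derivative f) _"])
       (simp add: fun_eq_iff field_simps power2_eq_square)
qed

lemma wirtinger_wirtinger_bar_potential:
  assumes "t > 0" "q $ 2 \<noteq> 0"
  shows "wirtinger j (wirtinger_bar k (\<lambda>q. complex_of_real (EH_potential t (EH_param0 q)))) q =
    EH_hess t q j k"
proof -
  define w where "w = q $ 1"
  define c where "c = q $ 2"
  define N where "N = EH_N q"
  define S where "S = EH_S t q"
  have nz: "N \<noteq> 0" "S \<noteq> 0" "c \<noteq> 0"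
    using assms EH_S_pos[of t q] by (simp_all add: N_def S_def c_def)
  have cc: "c * cnj c = of_real ((cmod c)\<^sup>2)" and ww: "w * cnj w = of_real ((cmod w)\<^sup>2)"
    by (simp_all only: complex_norm_square)
  have N: "(cmod w)\<^sup>2 = N - 1" by (simp add: N_def EH_N_def w_def)
  \<comment> \<open>\<open>L\<close> and \<open>R\<close> hold the values of the real functionals on
    the coordinate directions. Replacing the value at 1 by \<open>L1\<close>, \<open>L2\<close>,
    \<open>R1\<close> makes the values at \<i> cancel in every Wirtinger combination below.\<close>
  define L where "L = (\<lambda>j x. complex_of_real (EH_dlog q (axis j x)))"
  have L1: "L 1 1 = 2 * cnj w / of_real N + \<i> * L 1 \<i>" and L2: "L 2 1 = 1 / c + \<i> * L 2 \<i>"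
    using complex_linear_part(1)[of "2 * cnj w / of_real N"] complex_linear_part(1)[of "1 / c"]
    by (simp_all only: L_def EH_dlog_axis w_def c_def N_def diff_eq_eq)
  define R where "R = (\<lambda>x. complex_of_real (2 * Re (cnj w * x)))"
  have R1: "R 1 = 2 * cnj w + \<i> * R \<i>"
    using complex_linear_part(1)[of "cnj w"] by (simp add: R_def complex_eq_iff)
  define a where "a = complex_of_real ((cmod c * N)\<^sup>2 / S)"
  define D1 where "D1 = (\<lambda>h. a * of_real (EH_dlog q h) * (w / N) +
    S * (h $ 1 / N - w * R (h $ 1) / N\<^sup>2))"
  define D2 where "D2 = (\<lambda>h. a * of_real (EH_dlog q h) / (2 * cnj c) - S * cnj (h $ 2) / (2 * (cnj c)\<^sup>2))"
  have d1: "wirtinger j (wirtinger_bar 1 (\<lambda>q. complex_of_real (EH_potential t (EH_param0 q)))) q =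
      (D1 (axis j 1) - \<i> * D1 (axis j \<i>)) / 2" for j
  proof (rule wirtinger_cong_M4[OF _ assms(2)])
    show "((\<lambda>q. of_real (EH_S t q) * q $ 1 / of_real (EH_N q)) has_derivative D1) (at q)"
      using EH_dbar_deriv1[OF assms]
      by (simp add: D1_def a_def R_def w_def c_def N_def S_def)
  qed (simp add: wirtinger_bar_potential(1)[OF assms(1)])
  have d2: "wirtinger j (wirtinger_bar 2 (\<lambda>q. complex_of_real (EH_potential t (EH_param0 q)))) q =
      (D2 (axis j 1) - \<i> * D2 (axis j \<i>)) / 2" for j
  proof (rule wirtinger_cong_M4[OF _ assms(2)])
    show "((\<lambda>q. of_real (EH_S t q) / (2 * cnj (q $ 2))) has_derivative D2) (at q)"
      using EH_dbar_deriv2[OF assms]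
      by (simp add: D2_def a_def w_def c_def N_def S_def)
  qed (simp add: wirtinger_bar_potential(2)[OF assms(1)])
  note defs = w_def[symmetric] c_def[symmetric] N_def[symmetric] S_def[symmetric]
  have "wirtinger 1 (wirtinger_bar 1 (\<lambda>q. complex_of_real (EH_potential t (EH_param0 q)))) q = EH_hess t q 1 1"
  proof -
    have "wirtinger 1 (wirtinger_bar 1 (\<lambda>q. complex_of_real (EH_potential t (EH_param0 q)))) q =
      (a * L 1 1 * (w / N) + S * (1 / N - w * R 1 / N\<^sup>2)
      - \<i> * (a * L 1 \<i> * (w / N) + S * (\<i> / N - w * R \<i> / N\<^sup>2))) / 2"
      unfolding d1 by (simp add: D1_def L_def)
    also have "\<dots> = a * (w * cnj w) / N\<^sup>2 + S / N - S * (w * cnj w) / N\<^sup>2"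
      unfolding L1 R1 using nz by (simp add: field_simps power2_eq_square)
    also have "\<dots> = of_real ((cmod c * N)\<^sup>2 / S * (N - 1) / N\<^sup>2 + S / N - S * (N - 1) / N\<^sup>2)"
      unfolding ww N a_def by simp
    \<comment> \<open>With N - 1 for the squared modulus of w, the two last terms collapse to S /
      N^2.\<close>
    also have "(cmod c * N)\<^sup>2 / S * (N - 1) / N\<^sup>2 + S / N - S * (N - 1) / N\<^sup>2 =
        (cmod c)\<^sup>2 * (N - 1) / S + S / N\<^sup>2"
      using nz by (simp add: field_simps power2_eq_square)
    also have "of_real \<dots> = EH_hess t q 1 1"
      unfolding EH_hess_def defs N by simp
    finally show ?thesis .
  qed
  moreover have "wirtinger 2 (wirtinger_bar 1 (\<lambda>q. complex_of_real (EH_potential t (EH_param0 q)))) q = EH_hess t q 2 1"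
  proof -
    have "wirtinger 2 (wirtinger_bar 1 (\<lambda>q. complex_of_real (EH_potential t (EH_param0 q)))) q =
      (a * L 2 1 * (w / N) - \<i> * (a * L 2 \<i> * (w / N))) / 2"
      unfolding d1 by (simp add: D1_def L_def R_def)
    also have "\<dots> = a * w / (2 * c * N)"
      unfolding L2 using nz by (simp add: field_simps)
    also have "\<dots> = c * cnj c * of_real (N\<^sup>2 / S) * w / (2 * c * N)"
      unfolding a_def cc by (simp add: power_mult_distrib)
    also have "\<dots> = EH_hess t q 2 1"
      using nz unfolding EH_hess_def defs by (simp add: field_simps power2_eq_square)
    finally show ?thesis .
  qed
  moreover have "wirtinger 1 (wirtinger_bar 2 (\<lambda>q. complex_of_real (EH_potential t (EH_param0 q)))) q = EH_hess t q 1 2"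
  proof -
    have "wirtinger 1 (wirtinger_bar 2 (\<lambda>q. complex_of_real (EH_potential t (EH_param0 q)))) q =
      (a * L 1 1 / (2 * cnj c) - \<i> * (a * L 1 \<i> / (2 * cnj c))) / 2"
      unfolding d2 by (simp add: D2_def L_def)
    also have "\<dots> = a * cnj w / (2 * cnj c * N)"
      unfolding L1 using nz by (simp add: field_simps)
    also have "\<dots> = c * cnj c * of_real (N\<^sup>2 / S) * cnj w / (2 * cnj c * N)"
      unfolding a_def cc by (simp add: power_mult_distrib)
    also have "\<dots> = EH_hess t q 1 2"
      using nz unfolding EH_hess_def defs by (simp add: field_simps power2_eq_square)
    finally show ?thesis .
  qed
  moreover have "wirtinger 2 (wirtinger_bar 2 (\<lambda>q. complex_of_real (EH_potential t (EH_param0 q)))) q = EH_hess t q 2 2"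
  proof -
    have "wirtinger 2 (wirtinger_bar 2 (\<lambda>q. complex_of_real (EH_potential t (EH_param0 q)))) q =
      (a * L 2 1 / (2 * cnj c) - S / (2 * (cnj c)\<^sup>2)
       - \<i> * (a * L 2 \<i> / (2 * cnj c) - S * (- \<i>) / (2 * (cnj c)\<^sup>2))) / 2"
      unfolding d2 by (simp add: D2_def L_def)
    \<comment> \<open>The numerator \<open>a\<close> contains the squared modulus of
      \<open>c\<close>, which cancels the pole at the zero section; the mixed entries lose theirs in
      the same way.\<close>
    also have "\<dots> = a / (4 * (c * cnj c))"
      unfolding L2 using nz by (simp add: field_simps power2_eq_square)
    also have "\<dots> = EH_hess t q 2 2"
      using nz unfolding EH_hess_def defs a_def cc by (simp add: field_simps power2_eq_square)
    finally show ?thesis .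
  qed
  ultimately show ?thesis
    using exhaust_2[of j] exhaust_2[of k] by auto
qed

lemma EH_i_ddbar_eq:
  assumes "t > 0" "q $ 2 \<noteq> 0"
  shows "i_ddbar (\<lambda>q. complex_of_real (EH_potential t (EH_param0 q))) q X Y =
    \<i> * (\<Sum>j\<in>UNIV. \<Sum>k\<in>UNIV. EH_hess t q j k * (X $ j * cnj (Y $ k) - Y $ j * cnj (X $ k)))"
  unfolding i_ddbar_def wirtinger_wirtinger_bar_potential[OF assms] ..

section \<open>Extension across the zero section and the metric as a sum of two squares\<close>

lemma EH_hess_continuous:
  assumes "t > 0"
  shows "continuous_on UNIV (\<lambda>q. EH_hess t q j k)"
proof -
  have "EH_S t q \<noteq> 0" for q
    using EH_S_pos[OF assms, of q] by linarith
  moreover have "continuous_on UNIV (EH_S t)" "continuous_on UNIV EH_N"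
    unfolding EH_S_def EH_N_def by (intro continuous_intros)+
  ultimately show ?thesis
    unfolding EH_hess_def by (cases "j = 1"; cases "k = 1") (auto intro!: continuous_intros)
qed

text \<open>Off the zero section this is the computed Hessian. On it, the limit in
  \<open>EH_form\<close> is the value of the same expression, which is continuous
  everywhere.\<close>

lemma EH_form_param0:
  assumes "t > 0"
  shows "EH_form t EH_param0 q X Y =
    \<i> * (\<Sum>j\<in>UNIV. \<Sum>k\<in>UNIV. EH_hess t q j k * (X $ j * cnj (Y $ k) - Y $ j * cnj (X $ k)))"
proof -
  define \<omega> where "\<omega> = (\<lambda>q. \<i> * (\<Sum>j\<in>UNIV. \<Sum>k\<in>UNIV.
    EH_hess t q j k * (X $ j * cnj (Y $ k) - Y $ j * cnj (X $ k))))"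
  define \<eta> where "\<eta> = (\<lambda>q. i_ddbar (\<lambda>q. complex_of_real (EH_potential t (EH_param0 q))) q X Y)"
  have eq: "\<eta> q = \<omega> q" if "q $ 2 \<noteq> 0" for q
    using EH_i_ddbar_eq[OF assms that] by (simp add: \<eta>_def \<omega>_def)
  have "continuous_on UNIV \<omega>"
    unfolding \<omega>_def by (intro continuous_intros EH_hess_continuous assms)
  then have "(\<omega> \<longlongrightarrow> \<omega> q) (at q within {q. q $ 2 \<noteq> 0})"
    by (meson UNIV_I continuous_on_def subset_UNIV tendsto_within_subset)
  moreover have "eventually (\<lambda>q. \<omega> q = \<eta> q) (at q within {q. q $ 2 \<noteq> 0})"
    by (auto simp: eventually_at_filter eq)
  ultimately have lim: "(\<eta> \<longlongrightarrow> \<omega> q) (at q within {q. q $ 2 \<noteq> 0})"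
    using Lim_transform_eventually by blast
  have "Lim (at q within {q. q $ 2 \<noteq> 0}) \<eta> = \<omega> q" if "q $ 2 = 0"
  proof (rule tendsto_Lim[OF _ lim])
    \<comment> \<open>\<open>Lim\<close> is determined only along a nontrivial filter. A small move
      in the fibre direction leaves the zero section, so points of the complement come arbitrarily
      close.\<close>
    have "q islimpt {q. q $ 2 \<noteq> 0}"
      unfolding islimpt_approachable
    proof (intro allI impI)
      fix e :: real assume e: "e > 0"
      have "dist (q + axis 2 (of_real (e / 2))) q < e"
        using e by (simp add: dist_norm norm_vec_def L2_set_def UNIV_2)
      then show "\<exists>q'\<in>{q. q $ 2 \<noteq> 0}. q' \<noteq> q \<and> dist q' q < e"
        using e that by (intro bexI[of _ "q + axis 2 (of_real (e / 2))"]) (auto simp: vec_eq_iff intro!: exI[of _ 2])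
    qed
    then show "\<not> trivial_limit (at q within {q. q $ 2 \<noteq> 0})"
      by (simp add: trivial_limit_within)
  qed
  then show ?thesis
    using eq unfolding EH_form_def Let_def EH_param0_in_M4_iff \<eta>_def[symmetric] by (auto simp: \<omega>_def)
qed

text \<open>Completing the square in the fibre velocity uses up the mixed entries and the first
  summand of \<open>EH_hess t q 1 1\<close>. The shift in the square is the connection term of the
  Chern connection for the hermitian fibre norm u1, so the metric splits into a horizontal and a
  vertical part.\<close>

lemma EH_metric_param0:
  assumes "t > 0"
  shows "EH_metric t EH_param0 q v v = 2 * (EH_S t q * (cmod (v $ 1))\<^sup>2 / (EH_N q)\<^sup>2 +
    (EH_N q)\<^sup>2 / (4 * EH_S t q) *
      (cmod (v $ 2 + 2 * q $ 2 * cnj (q $ 1) * v $ 1 / of_real (EH_N q)))\<^sup>2)"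
proof -
  define w where "w = q $ 1"
  define c where "c = q $ 2"
  define N where "N = EH_N q"
  define S where "S = EH_S t q"
  define a where "a = v $ 1"
  define b where "b = v $ 2"
  have nz: "N \<noteq> 0" "S \<noteq> 0"
    using assms EH_S_pos[of t q] by (simp_all add: N_def S_def)
  have sq: "complex_of_real ((cmod x)\<^sup>2) = x * cnj x" for x
    by (simp only: complex_norm_square)
  have "EH_form t EH_param0 q v (\<i> *s v) =
      2 * (EH_hess t q 1 1 * a * cnj a + EH_hess t q 1 2 * a * cnj b +
        EH_hess t q 2 1 * b * cnj a + EH_hess t q 2 2 * b * cnj b)"
    unfolding EH_form_param0[OF assms] UNIV_2 a_def b_def by (simp add: algebra_simps)
  also have "\<dots> = 2 * (((c * cnj c) * (w * cnj w) / S + S / N\<^sup>2) * a * cnj a +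
      cnj w * c * (N / (2 * S)) * a * cnj b + w * cnj c * (N / (2 * S)) * b * cnj a +
      N\<^sup>2 / (4 * S) * b * cnj b)"
    unfolding EH_hess_def w_def[symmetric] c_def[symmetric] N_def[symmetric] S_def[symmetric]
    unfolding of_real_mult of_real_divide of_real_add sq by simp
  also have "\<dots> = 2 * (S * (a * cnj a) / N\<^sup>2 +
      N\<^sup>2 / (4 * S) * ((b + 2 * c * cnj w * a / N) * cnj (b + 2 * c * cnj w * a / N)))"
    using nz by (simp add: field_simps power2_eq_square)
  also have "\<dots> = of_real (2 * (S * (cmod a)\<^sup>2 / N\<^sup>2 +
      N\<^sup>2 / (4 * S) * (cmod (b + 2 * c * cnj w * a / N))\<^sup>2))"
    unfolding sq[symmetric] by simp
  finally show ?thesis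
    unfolding EH_metric_def w_def c_def N_def S_def a_def b_def by simp
qed

section \<open>Lengths of curves over a circle\<close>

text \<open>Induction on the number of break points strictly between the ends: splitting at any one
  of them lowers the count on both sides. Thus a property of adjacent pieces passes to the whole
  interval without an enumeration of \<open>P\<close>.\<close>

lemma finite_partition_chain:
  fixes P :: "'a::linorder set"
  assumes P: "finite P"
    and adjacent: "\<And>a b. a \<in> P \<Longrightarrow> b \<in> P \<Longrightarrow> a < b \<Longrightarrow> {a<..<b} \<inter> P = {} \<Longrightarrow> Q a b"
    and trans: "\<And>a b c. a < b \<Longrightarrow> b < c \<Longrightarrow> b \<in> P \<Longrightarrow> Q a b \<Longrightarrow> Q b c \<Longrightarrow> Q a c"
    and "a \<in> P" "b \<in> P" "a < b"
  shows "Q a b"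
  using \<open>a \<in> P\<close> \<open>b \<in> P\<close> \<open>a < b\<close>
proof (induction "card ({a<..<b} \<inter> P)" arbitrary: a b rule: less_induct)
  case less
  show ?case
  proof (cases "{a<..<b} \<inter> P = {}")
    case True
    then show ?thesis using adjacent less.prems by blast
  next
    case False
    then obtain c where c: "c \<in> P" "a < c" "c < b" by auto
    have "{a<..<c} \<inter> P \<subset> {a<..<b} \<inter> P" "{c<..<b} \<inter> P \<subset> {a<..<b} \<inter> P"
      using c by auto
    then have "Q a c" "Q c b"
      using less c P by (auto intro!: less.hyps psubset_card_mono)
    then show ?thesis using trans c by blast
  qed
qed

section \<open>Regularity of curves in the hypersurface, read in one chart\<close>

lemma EH_param_at_M3: "x \<in> EH_M3 C \<Longrightarrow> EH_param_at x = EH_param0"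
  by (auto simp: EH_param_at_def EH_M3_eq)

lemma EH_speed_M3:
  assumes "\<sigma> s \<in> EH_M3 C"
  shows "EH_speed t \<sigma> s = sqrt (EH_metric t EH_param0 ((inv EH_param0 \<circ> \<sigma>) s)
    (vector_derivative (inv EH_param0 \<circ> \<sigma>) (at s)) (vector_derivative (inv EH_param0 \<circ> \<sigma>) (at s)))"
  unfolding EH_speed_def EH_param_at_M3[OF assms] Let_def by simp

lemma EH_metric_nonneg: "t > 0 \<Longrightarrow> EH_metric t EH_param0 q v v \<ge> 0"
  using EH_S_pos[of t q] by (simp add: EH_metric_param0)

text \<open>\<open>EH_C1_curve\<close> provides a derivative only near each parameter. Since a < b,
  derivatives within the interval are unique, so the local ones are restrictions of the global
  \<open>D\<close>, which inherits their continuity.\<close>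

lemma C1_on_local:
  fixes c :: "real \<Rightarrow> 'a::real_normed_vector"
  assumes ab: "a < b" and loc: "\<And>s. s \<in> {a..b} \<Longrightarrow> \<exists>e>0. C1_on c ({a..b} \<inter> ball s e)"
  shows "C1_on c {a..b}"
proof -
  define D where "D = (\<lambda>s. vector_derivative c (at s within {a..b}))"
  have *: "(c has_vector_derivative D s) (at s within {a..b}) \<and> continuous (at s within {a..b}) D"
    if s: "s \<in> {a..b}" for s
  proof -
    obtain e c' where e: "e > 0" and cont: "continuous_on ({a..b} \<inter> ball s e) c'"
      and der: "\<And>r. r \<in> {a..b} \<inter> ball s e \<Longrightarrow>
        (c has_vector_derivative c' r) (at r within {a..b} \<inter> ball s e)"
      using loc[OF s] unfolding C1_on_def by blast
    \<comment> \<open>A derivative is insensitive to cutting the interval down to a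
      neighbourhood.\<close>
    have at_eq: "at r within {a..b} \<inter> ball s e = at r within {a..b}" if "r \<in> ball s e" for r
      using that by (intro at_within_nhd[of _ "ball s e"]) auto
    have der': "(c has_vector_derivative c' r) (at r within {a..b})" if "r \<in> {a..b} \<inter> ball s e" for r
      using der[OF that] that by (simp add: at_eq)
    have D: "D r = c' r" if "r \<in> {a..b} \<inter> ball s e" for r
      using vector_derivative_within_cbox[OF ab _ der'[OF that, folded box_real]] that
      by (auto simp: D_def)
    have "continuous_on ({a..b} \<inter> ball s e) D"
      by (rule continuous_on_eq[OF cont]) (use D in auto)
    then have "continuous (at s within {a..b}) D"
      using s e at_eq[of s] by (force simp: continuous_on_eq_continuous_within)
    then show ?thesis
      using der'[of s] D[of s] s e by auto
  qed
  then show ?thesis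
    unfolding C1_on_def continuous_on_eq_continuous_within by blast
qed

lemma EH_metric_continuous:
  assumes "t > 0" "continuous_on A p" "continuous_on A v"
  shows "continuous_on A (\<lambda>s. EH_metric t EH_param0 (p s) (v s) (v s))"
proof -
  have "EH_S t q \<noteq> 0" for q
    using EH_S_pos[OF assms(1), of q] by linarith
  moreover have "continuous_on A (\<lambda>s. EH_S t (p s))" "continuous_on A (\<lambda>s. EH_N (p s))"
    unfolding EH_S_def EH_N_def by (intro continuous_intros assms)+
  ultimately show ?thesis
    unfolding EH_metric_param0[OF assms(1)] using assms(2,3)
    by (intro continuous_intros) auto
qed

lemma EH_C1_curve_M3:
  assumes "t > 0" "a < b" "EH_C1_curve a b \<sigma>" "\<sigma> ` {a..b} \<subseteq> EH_M3 C"
  shows "continuous_on {a..b} (inv EH_param0 \<circ> \<sigma>)"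
    and "EH_speed t \<sigma> integrable_on {a..b}"
    and "\<And>s. s \<in> {a<..<b} \<Longrightarrow> (inv EH_param0 \<circ> \<sigma>) differentiable (at s)"
proof -
  define c where "c = inv EH_param0 \<circ> \<sigma>"
  have "C1_on c {a..b}"
  proof (rule C1_on_local[OF assms(2)])
    fix s assume s: "s \<in> {a..b}"
    then have "\<sigma> s \<in> EH_M3 C" using assms(4) by auto
    then show "\<exists>e>0. C1_on c ({a..b} \<inter> ball s e)"
      using assms(3) s unfolding EH_C1_curve_def c_def by (metis EH_param_at_M3)
  qed
  then obtain D where D: "continuous_on {a..b} D"
    "\<And>s. s \<in> {a..b} \<Longrightarrow> (c has_vector_derivative D s) (at s within {a..b})"
    unfolding C1_on_def by blast
  have D': "(c has_vector_derivative D s) (at s)" if "s \<in> {a<..<b}" for s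
    using D(2)[of s] that by (simp add: at_within_Icc_at)
  show cont: "continuous_on {a..b} (inv EH_param0 \<circ> \<sigma>)"
    using D(2) has_vector_derivative_continuous
    unfolding c_def continuous_on_eq_continuous_within by blast
  show "(inv EH_param0 \<circ> \<sigma>) differentiable (at s)" if "s \<in> {a<..<b}" for s
    using D'[OF that] unfolding c_def by (rule differentiableI_vector)
  have "(\<lambda>s. sqrt (EH_metric t EH_param0 (c s) (D s) (D s))) integrable_on {a..b}"
    using cont D(1) assms(1) unfolding c_def
    by (intro integrable_continuous_real continuous_intros EH_metric_continuous)
  \<comment> \<open>\<open>EH_speed\<close> uses the two-sided derivative, which is controlled only
    in the interior; the two ends form a negligible set.\<close>
  then show "EH_speed t \<sigma> integrable_on {a..b}"
  proof (rule integrable_spike)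
    show "EH_speed t \<sigma> s = sqrt (EH_metric t EH_param0 (c s) (D s) (D s))" if "s \<in> {a..b} - {a, b}" for s
    proof -
      have "\<sigma> s \<in> EH_M3 C" "s \<in> {a<..<b}" using that assms(4) by auto
      then show ?thesis
        using EH_speed_M3[of \<sigma> s C t] vector_derivative_at[OF D'[of s]] by (simp add: c_def)
    qed
  qed auto
qed

lemma EH_piecewise_C1_curve_M3:
  assumes "t > 0" "EH_piecewise_C1_curve \<sigma>" "\<sigma> ` {0..1} \<subseteq> EH_M3 C"
  obtains P where "finite P" "continuous_on {0..1} (inv EH_param0 \<circ> \<sigma>)"
    "EH_speed t \<sigma> integrable_on {0..1}"
    "\<And>s. s \<in> {0<..<1} - P \<Longrightarrow> (inv EH_param0 \<circ> \<sigma>) differentiable (at s)"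
proof -
  obtain P where P: "finite P" "{0, 1} \<subseteq> P" "P \<subseteq> {0..1}"
    "\<And>a b. a \<in> P \<Longrightarrow> b \<in> P \<Longrightarrow> a < b \<Longrightarrow> {a<..<b} \<inter> P = {} \<Longrightarrow> EH_C1_curve a b \<sigma>"
    using assms(2) unfolding EH_piecewise_C1_curve_def by (metis (no_types, lifting))
  define Q where "Q = (\<lambda>a b. continuous_on {a..b} (inv EH_param0 \<circ> \<sigma>) \<and>
    EH_speed t \<sigma> integrable_on {a..b} \<and>
    (\<forall>s\<in>{a<..<b} - P. (inv EH_param0 \<circ> \<sigma>) differentiable (at s)))"
  have "Q 0 1"
  proof (rule finite_partition_chain[OF P(1)])
    fix a b assume ab: "a \<in> P" "b \<in> P" "a < b" "{a<..<b} \<inter> P = {}"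
    moreover have "\<sigma> ` {a..b} \<subseteq> EH_M3 C"
      using assms(3) P(3) ab by fastforce
    ultimately show "Q a b"
      unfolding Q_def using EH_C1_curve_M3[OF assms(1) ab(3) P(4)[OF ab]] by simp
  next
    fix a b c :: real assume abc: "a < b" "b < c" "b \<in> P" and Q: "Q a b" "Q b c"
    have "{a..c} = {a..b} \<union> {b..c}" using abc by auto
    then have "continuous_on {a..c} (inv EH_param0 \<circ> \<sigma>)"
      using Q unfolding Q_def by (simp add: continuous_on_closed_Un)
    moreover have "EH_speed t \<sigma> integrable_on {a..c}"
      using Q abc unfolding Q_def
      by (intro Henstock_Kurzweil_Integration.integrable_combine[of a b c]) auto
    moreover have "s \<in> {a<..<b} - P \<or> s \<in> {b<..<c} - P" if "s \<in> {a<..<c} - P" for s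
      using that abc by (cases "s < b") (auto simp: not_less order.order_iff_strict)
    ultimately show "Q a c"
      using Q unfolding Q_def by blast
  qed (use P in auto)
  then show thesis using P(1) that unfolding Q_def by blast
qed

text \<open>The density N / sqrt (2 S) with \<open>K\<close> for N and \<open>x\<close> for the
  modulus of \<gamma>. Over a circle N is constant, so it is a function of one real variable; it
  makes sense for negative \<open>x\<close> too, which allows an antiderivative with a two-sided
  derivative at 0.\<close>

definition EH_radial_speed :: "real \<Rightarrow> real \<Rightarrow> real \<Rightarrow> real" where
  "EH_radial_speed t K x = K / sqrt (2 * sqrt ((x * K)\<^sup>2 + t ^ 4))"

lemma EH_radial_speed_alt:
  "EH_radial_speed t (EH_N q) (cmod (q $ 2)) = EH_N q / sqrt (2 * EH_S t q)"
  by (simp add: EH_radial_speed_def EH_S_def)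

text \<open>
  A velocity tangent to \<open>{|w| = const}\<close> changes the phase, but not the modulus, of the fibre
  coordinate through the connection term of the metric.
\<close>

lemma EH_metric_ge_radial:
  assumes "t > 0" "q $ 2 \<noteq> 0" "Re (cnj (q $ 1) * v $ 1) = 0"
  shows "EH_radial_speed t (EH_N q) (cmod (q $ 2)) * \<bar>Re (cnj (q $ 2) * v $ 2) / cmod (q $ 2)\<bar>
    \<le> sqrt (EH_metric t EH_param0 q v v)"
proof -
  define z where "z = v $ 2 + 2 * q $ 2 * cnj (q $ 1) * v $ 1 / of_real (EH_N q)"
  have S: "EH_S t q > 0" using assms(1) by (rule EH_S_pos)
  \<comment> \<open>Multiplied by \<open>cnj (q $ 2)\<close>, the connection term becomes a real
    multiple of \<open>cnj (q $ 1) * v $ 1\<close>, which is imaginary by assumption and so vanishes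
    from the real part.\<close>
  have "cnj (q $ 2) * z = cnj (q $ 2) * v $ 2 +
      of_real (2 * (cmod (q $ 2))\<^sup>2 / EH_N q) * (cnj (q $ 1) * v $ 1)"
    unfolding z_def of_real_divide of_real_mult complex_norm_square by (simp add: algebra_simps)
  then have "Re (cnj (q $ 2) * v $ 2) = Re (cnj (q $ 2) * z)"
    using assms(3) by (simp only: plus_complex.simps times_complex.simps Re_complex_of_real Im_complex_of_real)
  also have "\<bar>\<dots>\<bar> \<le> cmod (q $ 2) * cmod z"
    using abs_Re_le_cmod[of "cnj (q $ 2) * z"] by (simp add: norm_mult)
  finally have "\<bar>Re (cnj (q $ 2) * v $ 2) / cmod (q $ 2)\<bar> \<le> cmod z"
    using assms(2) by (simp add: abs_divide field_simps)
  then have "EH_radial_speed t (EH_N q) (cmod (q $ 2)) * \<bar>Re (cnj (q $ 2) * v $ 2) / cmod (q $ 2)\<bar>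
      \<le> EH_N q / sqrt (2 * EH_S t q) * cmod z"
    unfolding EH_radial_speed_alt using S by (intro mult_left_mono) (simp_all add: less_imp_le)
  also have "\<dots> \<le> sqrt (EH_metric t EH_param0 q v v)"
  proof (rule real_le_rsqrt)
    have "(EH_N q / sqrt (2 * EH_S t q) * cmod z)\<^sup>2 = 2 * ((EH_N q)\<^sup>2 / (4 * EH_S t q) * (cmod z)\<^sup>2)"
      using S by (simp add: power_mult_distrib power_divide)
    \<comment> \<open>The horizontal square is dropped here.\<close>
    also have "\<dots> \<le> EH_metric t EH_param0 q v v"
      using S unfolding EH_metric_param0[OF assms(1)] z_def by simp
    finally show "(EH_N q / sqrt (2 * EH_S t q) * cmod z)\<^sup>2 \<le> EH_metric t EH_param0 q v v" .
  qed
  finally show ?thesis .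
qed

lemma EH_metric_radial:
  assumes "t > 0" "v $ 1 = 0"
  shows "sqrt (EH_metric t EH_param0 q v v) =
    EH_radial_speed t (EH_N q) (cmod (q $ 2)) * cmod (v $ 2)"
proof -
  have "EH_metric t EH_param0 q v v = (EH_N q / sqrt (2 * EH_S t q) * cmod (v $ 2))\<^sup>2"
    using EH_S_pos[OF assms(1), of q] assms(2)
    by (simp add: EH_metric_param0[OF assms(1)] power_mult_distrib power_divide)
  then show ?thesis
    using EH_S_pos[OF assms(1), of q] by (simp add: EH_radial_speed_alt less_imp_le)
qed

text \<open>\<open>G\<close> of the modulus of \<gamma> plays the role of a calibration: along a
  curve it changes no faster than arc length, so its total drop bounds the length from
  below.\<close>

lemma EH_length_ge:
  assumes t: "t > 0" and \<sigma>: "EH_piecewise_C1_curve \<sigma>" "\<sigma> ` {0..1} \<subseteq> EH_M3 (sphere 0 r)"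
    and start: "\<sigma> 0 = EH_param0 p" "p $ 2 \<noteq> 0" and stop: "\<sigma> 1 = EH_param0 p'" "p' $ 2 = 0"
    and G: "\<And>x. (G has_real_derivative EH_radial_speed t (1 + r\<^sup>2) x) (at x)"
  shows "G (cmod (p $ 2)) - G 0 \<le> EH_length t \<sigma>"
proof -
  define c where "c = inv EH_param0 \<circ> \<sigma>"
  obtain P where P: "finite P" and cont: "continuous_on {0..1} c"
    and int: "EH_speed t \<sigma> integrable_on {0..1}"
    and diff: "\<And>s. s \<in> {0<..<1} - P \<Longrightarrow> c differentiable (at s)"
    using EH_piecewise_C1_curve_M3[OF t \<sigma>] unfolding c_def by metis
  have c0: "c 0 = p" and c1: "c 1 = p'"
    using start stop by (simp_all add: c_def)
  have circ: "cmod (c s $ 1) = r" if "s \<in> {0..1}" for s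
  proof -
    have "\<sigma> s \<in> EH_M3 (sphere 0 r)" using \<sigma>(2) that by auto
    then show ?thesis by (auto simp: EH_M3_eq c_def)
  qed
  have nonneg: "EH_speed t \<sigma> s \<ge> 0" if "s \<in> {0..1}" for s
  proof -
    have "\<sigma> s \<in> EH_M3 (sphere 0 r)" using \<sigma>(2) that by auto
    from EH_speed_M3[where \<sigma> = \<sigma> and s = s, OF this] show ?thesis by (simp add: EH_metric_nonneg[OF t])
  qed
  \<comment> \<open>The parameters of contact with the zero section form a compact set, so there is
    a first one, \<open>\<tau>\<close>. Before it the modulus of \<gamma> is differentiable wherever
    the curve is.\<close>
  define Z where "Z = {0..1} \<inter> (\<lambda>s. c s $ 2) -` {0}"
  have "closed Z"
    unfolding Z_def by (intro continuous_closed_preimage continuous_intros cont)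
  then have "compact ({0..1} \<inter> Z)" by (intro compact_Int_closed compact_Icc)
  then have "compact Z" by (simp add: Z_def)
  moreover have "1 \<in> Z" using c1 stop by (simp add: Z_def)
  ultimately obtain \<tau> where \<tau>Z: "\<tau> \<in> Z" "\<And>s. s \<in> Z \<Longrightarrow> \<tau> \<le> s"
    using compact_attains_inf[of Z] by (metis empty_iff)
  then have \<tau>: "0 \<le> \<tau>" "\<tau> \<le> 1" "c \<tau> $ 2 = 0"
    by (simp_all add: Z_def)
  have nz: "c s $ 2 \<noteq> 0" if "s \<in> {0..<\<tau>}" for s
    using that \<tau>Z(2)[of s] \<tau> by (auto simp: Z_def)
  define v where "v = (\<lambda>s. vector_derivative c (at s))"
  \<comment> \<open>The minus sign turns the drop of \<open>G\<close> from the start to the zero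
    section into a positive quantity. At break points and at both ends the default 0 lies below the
    speed, which is nonnegative.\<close>
  define f' where "f' = (\<lambda>s. if s \<in> {0<..<\<tau>} - P then
    - (EH_radial_speed t (1 + r\<^sup>2) (cmod (c s $ 2)) * (Re (cnj (c s $ 2) * v s $ 2) / cmod (c s $ 2))) else 0)"
  have v: "(c has_vector_derivative v s) (at s)" if "s \<in> {0<..<\<tau>} - P" for s
    using diff[of s] that \<tau> unfolding v_def by (auto simp: vector_derivative_works)
  have "(f' has_integral (- G (cmod (c \<tau> $ 2)) - - G (cmod (c 0 $ 2)))) {0..\<tau>}"
  proof (rule fundamental_theorem_of_calculus_interior_strong[OF P \<tau>(1)])
    show "((\<lambda>s. - G (cmod (c s $ 2))) has_vector_derivative f' s) (at s)" if s: "s \<in> {0<..<\<tau>} - P" for s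
    proof -
      have "((\<lambda>s. c s $ 2) has_derivative (\<lambda>h. h *\<^sub>R v s $ 2)) (at s)"
        using has_derivative_compose[OF v[OF s, unfolded has_vector_derivative_def] has_derivative_vec_nth, of 2]
        by simp
      from has_derivative_compose[OF this has_derivative_norm] nz[of s] s
      have "((\<lambda>s. cmod (c s $ 2)) has_derivative (\<lambda>h. (h *\<^sub>R v s $ 2) \<bullet> sgn (c s $ 2))) (at s)"
        by auto
      then have "((\<lambda>s. cmod (c s $ 2)) has_derivative
          (\<lambda>h. h * (Re (cnj (c s $ 2) * v s $ 2) / cmod (c s $ 2)))) (at s)"
        by (rule has_derivative_eq_rhs)
           (simp add: fun_eq_iff inner_complex_def sgn_eq Re_divide_of_real Im_divide_of_real field_simps add_divide_distrib)
      from has_derivative_minus[OF DERIV_compose_FDERIV[OF G this]] show ?thesis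
        unfolding has_vector_derivative_def
        by (rule has_derivative_eq_rhs) (use s in \<open>auto simp: f'_def fun_eq_iff\<close>)
    qed
    have "continuous_on {0..\<tau>} c"
      using \<tau>(2) by (intro continuous_on_subset[OF cont]) simp
    then have "continuous_on {0..\<tau>} (\<lambda>s. cmod (c s $ 2))"
      by (intro continuous_on_norm continuous_on_component)
    moreover have "continuous_on UNIV G"
      by (intro continuous_at_imp_continuous_on ballI DERIV_isCont[OF G])
    ultimately show "continuous_on {0..\<tau>} (\<lambda>s. - G (cmod (c s $ 2)))"
      by (metis continuous_on_minus continuous_on_compose2 subset_UNIV)
  qed
  then have I: "(f' has_integral (G (cmod (p $ 2)) - G 0)) {0..\<tau>}"
    using \<tau>(3) c0 by simp
  have "f' s \<le> EH_speed t \<sigma> s" if s01: "s \<in> {0..\<tau>}" for s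
  proof (cases "s \<in> {0<..<\<tau>} - P")
    case True
    then have s: "s \<in> {0<..<1}" using \<tau> by auto
    have N: "EH_N (c s) = 1 + r\<^sup>2" using circ[of s] s by (simp add: EH_N_def)
    \<comment> \<open>N along the curve has two derivatives: the one of the chain rule, and zero
      because the curve stays over the circle. Their equality is the tangency condition of
      \<open>EH_metric_ge_radial\<close>.\<close>
    have "(EH_N \<circ> c has_derivative (\<lambda>h. 2 * Re (cnj (c s $ 1) * (h *\<^sub>R v s) $ 1))) (at s)"
      using has_derivative_compose[OF v[OF True, unfolded has_vector_derivative_def] EH_N_deriv]
      by (simp add: o_def)
    moreover have "(EH_N \<circ> c has_derivative (\<lambda>h. 0)) (at s)"
      by (rule has_derivative_transform_within_open[of "\<lambda>_. 1 + r\<^sup>2" _ _ _ "{0<..<1}"])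
         (use s circ in \<open>auto simp: EH_N_def\<close>)
    ultimately have "(\<lambda>h. 2 * Re (cnj (c s $ 1) * (h *\<^sub>R v s) $ 1)) = (\<lambda>h. 0)"
      by (rule has_derivative_unique)
    from fun_cong[OF this, of 1] have Re0: "Re (cnj (c s $ 1) * v s $ 1) = 0"
      by simp
    have "f' s \<le> EH_radial_speed t (EH_N (c s)) (cmod (c s $ 2)) *
        \<bar>Re (cnj (c s $ 2) * v s $ 2) / cmod (c s $ 2)\<bar>"
    proof -
      have "EH_radial_speed t (EH_N (c s)) (cmod (c s $ 2)) \<ge> 0"
        using EH_S_pos[OF t, of "c s"] unfolding EH_radial_speed_alt by (simp add: less_imp_le)
      from mult_left_mono[OF abs_ge_minus_self this]
      show ?thesis using True by (simp only: N f'_def if_True mult_minus_right)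
    qed
    also have "\<dots> \<le> EH_speed t \<sigma> s"
    proof -
      have "\<sigma> s \<in> EH_M3 (sphere 0 r)" using \<sigma>(2) s by auto
      from EH_speed_M3[where \<sigma> = \<sigma> and s = s, OF this] show ?thesis
        using EH_metric_ge_radial[OF t _ Re0] nz[of s] True unfolding c_def[symmetric] v_def by simp
    qed
    finally show ?thesis .
  next
    case False
    then show ?thesis using nonneg[of s] s01 \<tau> by (auto simp: f'_def)
  qed
  moreover have int\<tau>: "EH_speed t \<sigma> integrable_on {0..\<tau>}"
    using int \<tau> by (auto intro: integrable_on_subinterval)
  ultimately have "G (cmod (p $ 2)) - G 0 \<le> integral {0..\<tau>} (EH_speed t \<sigma>)"
    by (intro has_integral_le[OF I integrable_integral])
  also have "\<dots> \<le> EH_length t \<sigma>"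
    unfolding EH_length_def using \<tau> nonneg int int\<tau> by (intro integral_subset_le) auto
  finally show ?thesis .
qed

section \<open>Explicit curves from a point to the zero section\<close>

lemma EH_piecewise_C1_curve_param0:
  assumes "C1_on c {0..1}"
  shows "EH_piecewise_C1_curve (EH_param0 \<circ> c)"
proof -
  have "EH_C1_curve 0 1 (EH_param0 \<circ> c)"
    unfolding EH_C1_curve_def
  proof (intro ballI exI[of _ 1] conjI)
    fix s :: real
    have *: "EH_param_at ((EH_param0 \<circ> c) s) = EH_param0" by (simp add: EH_param_at_def)
    show "(EH_param0 \<circ> c) ` ({0..1} \<inter> ball s 1) \<subseteq> range (EH_param_at ((EH_param0 \<circ> c) s))"
      unfolding * by auto
    have "inv EH_param0 \<circ> (EH_param0 \<circ> c) = c" by (simp add: fun_eq_iff)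
    then show "C1_on (inv (EH_param_at ((EH_param0 \<circ> c) s)) \<circ> (EH_param0 \<circ> c)) ({0..1} \<inter> ball s 1)"
      using assms unfolding * C1_on_def
      by (auto intro: continuous_on_subset has_vector_derivative_within_subset)
  qed simp
  then show ?thesis
    unfolding EH_piecewise_C1_curve_def by (intro exI[of _ "{0, 1}"]) auto
qed

text \<open>As a sum of bounded linear images of its entries, \<open>vector\<close> inherits
  derivatives and continuity from them.\<close>

lemma vector_2_eq_axis: "(vector [a, b] :: complex ^ 2) = axis 1 a + axis 2 b"
  by (simp add: vec_eq_iff forall_2)

lemma bounded_linear_axis: "bounded_linear (axis i :: complex \<Rightarrow> complex ^ 2)"
  by (intro linear_conv_bounded_linear[THEN iffD1] linearI) (auto simp: vec_eq_iff axis_def)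

lemma has_vector_derivative_vector_2:
  fixes f g :: "real \<Rightarrow> complex"
  assumes "(f has_vector_derivative f') (at s within A)" "(g has_vector_derivative g') (at s within A)"
  shows "((\<lambda>s. vector [f s, g s] :: complex ^ 2) has_vector_derivative vector [f', g']) (at s within A)"
  unfolding vector_2_eq_axis
  by (intro has_vector_derivative_add bounded_linear.has_vector_derivative[OF bounded_linear_axis] assms)

lemma continuous_on_vector_2:
  fixes f g :: "real \<Rightarrow> complex"
  assumes "continuous_on A f" "continuous_on A g"
  shows "continuous_on A (\<lambda>s. vector [f s, g s] :: complex ^ 2)"
  unfolding vector_2_eq_axis
  by (intro continuous_on_add bounded_linear.continuous_on[OF bounded_linear_axis] assms)

text \<open>
  The curves with \<open>\<theta> = 0\<close> are minimizing.  The others show that every point of the zero section is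
  reached by some curve: the infimum of the empty set is unspecified.
\<close>

definition EH_radial_curve :: "complex ^ 2 \<Rightarrow> real \<Rightarrow> real \<Rightarrow> EH_point" where
  "EH_radial_curve p \<theta> =
    EH_param0 \<circ> (\<lambda>s. vector [p $ 1 * cis (\<theta> * s), of_real (1 - s) * p $ 2])"

lemma radial_chart_deriv:
  "((\<lambda>s. vector [p $ 1 * cis (\<theta> * s), of_real (1 - s) * p $ 2] :: complex ^ 2)
    has_vector_derivative vector [p $ 1 * (of_real \<theta> * \<i> * cis (\<theta> * s)), - p $ 2])
    (at s within A)"
  by (intro has_vector_derivative_vector_2)
     (auto intro!: derivative_eq_intros simp: has_vector_derivative_def scaleR_conv_of_real fun_eq_iff algebra_simps)

lemma EH_radial_curve_C1: "EH_piecewise_C1_curve (EH_radial_curve p \<theta>)"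
  unfolding EH_radial_curve_def
proof (rule EH_piecewise_C1_curve_param0)
  show "C1_on (\<lambda>s. vector [p $ 1 * cis (\<theta> * s), of_real (1 - s) * p $ 2] :: complex ^ 2) {0..1}"
    unfolding C1_on_def
    by (rule exI, rule conjI[rotated], rule ballI, rule radial_chart_deriv)
       (intro continuous_on_vector_2 continuous_intros)
qed

lemma EH_radial_curve_M3: "EH_radial_curve p \<theta> s \<in> EH_M3 (sphere 0 (cmod (p $ 1)))"
  unfolding EH_M3_eq EH_radial_curve_def o_def
  by (rule CollectI, rule exI, rule conjI[OF refl]) (simp add: norm_mult)

lemma EH_radial_curve_ends:
  "EH_radial_curve p \<theta> 0 = EH_param0 p"
  "EH_radial_curve p \<theta> 1 = EH_param0 (vector [p $ 1 * cis \<theta>, 0])"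
proof -
  have "vector [p $ 1, p $ 2] = p" by (simp add: vec_eq_iff forall_2)
  then show "EH_radial_curve p \<theta> 0 = EH_param0 p"
    by (simp add: EH_radial_curve_def)
qed (simp add: EH_radial_curve_def)

lemma EH_radial_length:
  assumes t: "t > 0"
    and G: "\<And>x. (G has_real_derivative EH_radial_speed t (1 + (cmod (p $ 1))\<^sup>2) x) (at x)"
  shows "EH_length t (EH_radial_curve p 0) = G (cmod (p $ 2)) - G 0"
proof -
  define c where "c = (\<lambda>s. vector [p $ 1 * cis (0 * s), of_real (1 - s) * p $ 2] :: complex ^ 2)"
  have c: "inv EH_param0 \<circ> EH_radial_curve p 0 = c"
    by (simp add: EH_radial_curve_def c_def fun_eq_iff)
  have D: "vector_derivative c (at s) = vector [0, - p $ 2]" for s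
    using vector_derivative_at[OF radial_chart_deriv[of p 0 s UNIV]] by (simp add: c_def)
  have "EH_speed t (EH_radial_curve p 0) s =
      EH_radial_speed t (1 + (cmod (p $ 1))\<^sup>2) ((1 - s) * cmod (p $ 2)) * cmod (p $ 2)" if "s \<in> {0..1}" for s
  proof -
    have "EH_N (c s) = 1 + (cmod (p $ 1))\<^sup>2" "cmod (c s $ 2) = (1 - s) * cmod (p $ 2)"
      using that by (simp_all add: c_def EH_N_def norm_mult del: of_real_diff)
    then show ?thesis
      unfolding EH_speed_M3[OF EH_radial_curve_M3] c D by (simp add: EH_metric_radial[OF t])
  qed
  moreover have "((\<lambda>s. EH_radial_speed t (1 + (cmod (p $ 1))\<^sup>2) ((1 - s) * cmod (p $ 2)) * cmod (p $ 2))
      has_integral (- G ((1 - 1) * cmod (p $ 2)) - - G ((1 - 0) * cmod (p $ 2)))) {0..1}"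
  proof (rule fundamental_theorem_of_calculus)
    fix s :: real
    have "((\<lambda>s. (1 - s) * cmod (p $ 2)) has_real_derivative - cmod (p $ 2)) (at s within {0..1})"
      by (auto intro!: derivative_eq_intros)
    from DERIV_minus[OF DERIV_chain2[OF G this]]
    show "((\<lambda>s. - G ((1 - s) * cmod (p $ 2))) has_vector_derivative
        EH_radial_speed t (1 + (cmod (p $ 1))\<^sup>2) ((1 - s) * cmod (p $ 2)) * cmod (p $ 2)) (at s within {0..1})"
      by (simp add: has_real_derivative_iff_has_vector_derivative)
  qed simp
  ultimately have "(EH_speed t (EH_radial_curve p 0) has_integral (G (cmod (p $ 2)) - G 0)) {0..1}"
    by (subst has_integral_cong) simp_all
  then show ?thesis
    unfolding EH_length_def by (rule integral_unique)
qed

section \<open>Euler's integral\<close>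

abbreviation slit_plane :: "complex set" where
  "slit_plane \<equiv> - (complex_of_real ` {1..})"

lemma slit_plane_open: "open slit_plane"
proof -
  have "closed (complex_of_real ` {1..})"
    by (intro closed_injective_linear_image) (auto intro: injI linear_of_real)
  then show ?thesis by (simp add: open_Compl)
qed

text \<open>The removed ray points away from 0, so shrinking towards 0 never meets it. This gives
  star-shapedness, and it keeps 1 - z s^2 off the branch cut of the power.\<close>

lemma slit_plane_scale:
  assumes "z \<in> slit_plane" "s \<in> {0..1}"
  shows "complex_of_real s * z \<in> slit_plane"
proof
  assume "complex_of_real s * z \<in> complex_of_real ` {1..}"
  then obtain x where x: "1 \<le> x" "complex_of_real s * z = of_real x" by auto
  then have s: "s > 0" using assms by (cases "s = 0") auto
  then have "z = of_real (x / s)" using x(2) by (simp add: field_simps)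
  moreover have "x / s \<ge> 1" using x s assms by (simp add: field_simps)
  ultimately show False using assms(1) by (metis ComplD atLeast_iff imageI)
qed

lemma slit_plane_connected: "connected slit_plane"
proof (rule starlike_imp_connected)
  show "starlike slit_plane"
    unfolding starlike_def
  proof (intro bexI[of _ 0] ballI)
    fix z assume z: "z \<in> slit_plane"
    show "closed_segment 0 z \<subseteq> slit_plane"
    proof
      fix w assume "w \<in> closed_segment 0 z"
      then obtain u where "u \<in> {0..1}" "w = of_real u * z"
        by (auto simp: closed_segment_def scaleR_conv_of_real)
      then show "w \<in> slit_plane" using slit_plane_scale[OF z, of u] by simp
    qed
  qed auto
qed

lemma one_minus_slit_plane: "z \<in> slit_plane \<Longrightarrow> 1 - z \<notin> \<real>\<^sub>\<le>\<^sub>0"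
proof
  assume z: "z \<in> slit_plane" and "1 - z \<in> \<real>\<^sub>\<le>\<^sub>0"
  then obtain x where "x \<le> 0" "1 - z = of_real x" by (auto elim: nonpos_Reals_cases)
  then have "z = of_real (1 - x)" "1 - x \<ge> 1" by (auto simp: algebra_simps)
  with z show False by (metis ComplD atLeast_iff imageI)
qed

text \<open>
  By this quotient the Gauss series with \<open>a = 1/2\<close> and \<open>c = 3/2\<close> is the termwise integral over \<open>[0, 1]\<close> of the
  binomial series of \<open>(1 - z s\<^sup>2) powr (- b)\<close>.
\<close>

lemma pochhammer_half_quotient:
  "pochhammer (1/2 :: complex) n / pochhammer (3/2) n = 1 / of_nat (2 * n + 1)"
proof (induction n)
  case (Suc n)
  have "(1/2 :: complex) + of_nat n = of_nat (2 * n + 1) / 2"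
    "(3/2 :: complex) + of_nat n = of_nat (2 * Suc n + 1) / 2"
    by (simp_all add: field_simps)
  moreover have "of_nat (2 * n + 1) \<noteq> (0 :: complex)"
    by (simp only: of_nat_eq_0_iff)
  moreover have "1 / a * (a / 2 / (d / 2)) = 1 / d" if "a \<noteq> 0" for a d :: complex
    using that by simp
  ultimately show ?case
    using Suc.IH by (simp only: pochhammer_Suc times_divide_times_eq [symmetric])
qed simp

lemma continuous_on_powr_slit:
  fixes f :: "'a::topological_space \<Rightarrow> complex"
  assumes "continuous_on A f" "\<And>x. x \<in> A \<Longrightarrow> f x \<notin> \<real>\<^sub>\<le>\<^sub>0"
  shows "continuous_on A (\<lambda>x. f x powr c)"
proof (rule continuous_on_compose2[where g = "\<lambda>w. w powr c" and t = "- \<real>\<^sub>\<le>\<^sub>0"])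
  show "continuous_on (- \<real>\<^sub>\<le>\<^sub>0) (\<lambda>w::complex. w powr c)"
    by (intro holomorphic_on_imp_continuous_on holomorphic_intros) auto
qed (use assms in auto)

lemma hyp_integrand_continuous:
  assumes "z \<in> slit_plane"
  shows "continuous_on {0..1} (\<lambda>s. (1 - z * of_real (s\<^sup>2)) powr c)"
proof -
  have "1 - z * of_real (s\<^sup>2) \<notin> \<real>\<^sub>\<le>\<^sub>0" if "s \<in> {0..1}" for s :: real
    using slit_plane_scale[OF assms, of "s\<^sup>2"] that
    by (intro one_minus_slit_plane) (auto simp: mult.commute power_le_one)
  then show ?thesis
    by (intro continuous_on_powr_slit continuous_intros)
qed

text \<open>Differentiation under the integral is carried out on balls, which are convex while the
  slit plane is not; holomorphy is local, so balls suffice.\<close>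

lemma hyp_integral_holomorphic:
  "(\<lambda>z. integral {0..1} (\<lambda>s. (1 - z * of_real (s\<^sup>2)) powr c)) holomorphic_on slit_plane"
proof -
  have "(\<lambda>z. integral (cbox 0 1) (\<lambda>s. (1 - z * of_real (s\<^sup>2)) powr c)) holomorphic_on ball a e"
    if a: "ball a e \<subseteq> slit_plane" for a e
  proof (rule leibniz_rule_holomorphic[where fx =
        "\<lambda>z s. - of_real (s\<^sup>2) * c * (1 - z * of_real (s\<^sup>2)) powr (c - 1)"])
    have nn: "1 - z * of_real (s\<^sup>2) \<notin> \<real>\<^sub>\<le>\<^sub>0" if "z \<in> ball a e" "s \<in> {0..1}" for z and s :: real
      using slit_plane_scale[of z "s\<^sup>2"] that a
      by (intro one_minus_slit_plane) (auto simp: mult.commute power_le_one)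
    show "((\<lambda>z. (1 - z * of_real (s\<^sup>2)) powr c) has_field_derivative
        - of_real (s\<^sup>2) * c * (1 - z * of_real (s\<^sup>2)) powr (c - 1)) (at z within ball a e)"
      if "z \<in> ball a e" "s \<in> cbox 0 1" for z s
      using nn[OF that(1), of s] that(2)
      by (auto intro!: derivative_eq_intros simp: mult_ac)
    show "(\<lambda>s. (1 - z * of_real (s\<^sup>2)) powr c) integrable_on cbox 0 1" if "z \<in> ball a e" for z
      unfolding box_real using that a
      by (intro integrable_continuous_real hyp_integrand_continuous) auto
    show "continuous_on (ball a e \<times> cbox 0 1)
        (\<lambda>(z, s). - of_real (s\<^sup>2) * c * (1 - z * of_real (s\<^sup>2)) powr (c - 1))"
      unfolding split_beta by (intro continuous_intros continuous_on_powr_slit nn) auto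
  qed simp
  then have "\<exists>e>0. (\<lambda>z. integral {0..1} (\<lambda>s. (1 - z * of_real (s\<^sup>2)) powr c)) holomorphic_on ball a e"
    if "a \<in> slit_plane" for a
    using that slit_plane_open unfolding open_contains_ball by (metis box_real(2))
  then show ?thesis
    by (meson analytic_imp_holomorphic analytic_on_def)
qed

lemma hyp_integral_sums:
  fixes b z :: complex
  assumes "norm z < 1"
  shows "(\<lambda>n. pochhammer (1/2) n * pochhammer b n / (pochhammer (3/2) n * fact n) * z ^ n) sums
    integral {0..1} (\<lambda>s. (1 - z * of_real (s\<^sup>2)) powr (- b))"
proof -
  define f where "f = (\<lambda>n (s::real). pochhammer b n / fact n * z ^ n * of_real s ^ (2 * n))"
  have binom: "(\<lambda>n. pochhammer b n / fact n * w ^ n) sums (1 - w) powr (- b)"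
    if "norm w < 1" for w :: complex
    using gen_binomial_complex[of "- w" "- b"] that
    by (simp add: gbinomial_pochhammer power_minus[of w] mult_ac)
  have norm_z: "norm (z * of_real (s\<^sup>2)) \<le> norm z" if "s \<in> {0..1}" for s :: real
    using that mult_left_le[of "s\<^sup>2" "norm z"] by (simp add: norm_mult norm_power power_le_one)
  have "uniform_limit {0..1} (\<lambda>n s. \<Sum>i<n. f i s) (\<lambda>s. \<Sum>i. f i s) sequentially"
  proof (rule Weierstrass_m_test)
    show "norm (f n s) \<le> norm (pochhammer b n / fact n * z ^ n)" if "s \<in> {0..1}" for n s
      unfolding f_def norm_mult[of _ "of_real s ^ (2 * n)"] using that
      by (intro mult_left_le) (auto simp: norm_power power_le_one)
    \<comment> \<open>A point of modulus strictly between that of \<open>z\<close> and 1: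
      convergence of the binomial series there implies absolute convergence at
      \<open>z\<close>.\<close>
    define x where "x = complex_of_real ((1 + norm z) / 2)"
    have x: "norm x < 1" "norm z < norm x"
      unfolding x_def norm_of_real using assms by auto
    show "summable (\<lambda>n. norm (pochhammer b n / fact n * z ^ n))"
      using binom[OF x(1)] x(2) by (intro powser_insidea[of _ x]) (auto simp: sums_iff)
  qed
  then have "uniform_limit {0..1} (\<lambda>n s. \<Sum>i<n. f i s)
      (\<lambda>s. (1 - z * of_real (s\<^sup>2)) powr (- b)) sequentially"
  proof (rule iffD1[OF uniform_limit_cong', rotated 2])
    show "(\<Sum>i. f i s) = (1 - z * of_real (s\<^sup>2)) powr (- b)" if "s \<in> {0..1}" for s
      using binom[of "z * of_real (s\<^sup>2)"] norm_z[OF that] assms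
      by (simp add: f_def sums_iff power_mult_distrib mult_ac flip: power_mult)
  qed simp
  then obtain I J where I: "\<And>n. ((\<lambda>s. \<Sum>i<n. f i s) has_integral I n) {0..1}"
    and J: "((\<lambda>s. (1 - z * of_real (s\<^sup>2)) powr (- b)) has_integral J) {0..1}" and lim: "I \<longlonglongrightarrow> J"
    by (rule uniform_limit_integral) (auto simp: f_def intro!: continuous_intros)
  have mono: "((\<lambda>s. f n s) has_integral
      (pochhammer (1/2) n * pochhammer b n / (pochhammer (3/2) n * fact n) * z ^ n)) {0..1}" for n
  proof -
    have "((\<lambda>s. s ^ (2 * n)) has_integral
        (1 ^ (2 * n + 1) / real (2 * n + 1) - 0 ^ (2 * n + 1) / real (2 * n + 1))) {0..1}"
    proof (rule fundamental_theorem_of_calculus)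
      have "((\<lambda>s. s ^ (2 * n + 1) / real (2 * n + 1)) has_real_derivative s ^ (2 * n)) (at s within {0..1})" for s
        using DERIV_cdivide[OF DERIV_pow[of "2 * n + 1" s "{0..1}"], of "real (2 * n + 1)"]
        by (simp del: of_nat_add of_nat_Suc)
      then show "((\<lambda>s. s ^ (2 * n + 1) / real (2 * n + 1)) has_vector_derivative s ^ (2 * n)) (at s within {0..1})"
        for s by (simp only: has_real_derivative_iff_has_vector_derivative)
    qed simp
    from has_integral_linear[OF this bounded_linear_of_real[where 'a = complex]]
    have "((\<lambda>s. complex_of_real (s ^ (2 * n))) has_integral of_real (1 / real (2 * n + 1))) {0..1}"
      by (simp add: o_def)
    note I = has_integral_mult_right[OF this, of "pochhammer b n / fact n * z ^ n"]
    have q: "complex_of_real (1 / real (2 * n + 1)) = pochhammer (1/2) n / pochhammer (3/2) n"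
      unfolding pochhammer_half_quotient by simp
    show ?thesis
      using I unfolding q by (simp add: f_def mult_ac)
  qed
  have "((\<lambda>s. \<Sum>i<n. f i s) has_integral
      (\<Sum>i<n. pochhammer (1/2) i * pochhammer b i / (pochhammer (3/2) i * fact i) * z ^ i)) {0..1}" for n
    by (intro has_integral_sum mono) simp
  then have "I = (\<lambda>n. \<Sum>i<n. pochhammer (1/2) i * pochhammer b i / (pochhammer (3/2) i * fact i) * z ^ i)"
    using I has_integral_unique by blast
  then show ?thesis
    using lim J by (simp add: sums_def integral_unique)
qed

text \<open>The integral witnesses the specification under \<open>SOME\<close>, so the chosen
  function satisfies it as well. Both agree on the unit disc, hence on the connected slit plane by
  analytic continuation.\<close>

lemma gauss_hypergeometric_half:
  assumes "z \<in> slit_plane"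
  shows "gauss_hypergeometric (1/2) b (3/2) z =
    integral {0..1} (\<lambda>s. (1 - z * of_real (s\<^sup>2)) powr (- b))"
proof -
  define g where "g = (\<lambda>z. integral {0..1} (\<lambda>s. (1 - z * of_real (s\<^sup>2)) powr (- b)))"
  define P where "P = (\<lambda>h. h holomorphic_on slit_plane \<and>
     (\<forall>z\<in>ball 0 1. (\<lambda>n. pochhammer (1/2) n * pochhammer b n / (pochhammer (3/2) n * fact n) * z ^ n)
        sums h z))"
  have "P g"
    unfolding P_def g_def using hyp_integral_holomorphic[of "- b"] hyp_integral_sums[of _ b] by simp
  then have P: "P (gauss_hypergeometric (1/2) b (3/2))"
    unfolding gauss_hypergeometric_def P_def[symmetric] by (rule someI[of P g])
  have "gauss_hypergeometric (1/2) b (3/2) z = g z"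
  proof (rule analytic_continuation_open[of "ball 0 1" slit_plane "gauss_hypergeometric (1/2) b (3/2)" g])
    show "ball 0 1 \<subseteq> slit_plane" by auto
    show "gauss_hypergeometric (1/2) b (3/2) z = g z" if "z \<in> ball 0 1" for z
      using P \<open>P g\<close> that sums_unique2 unfolding P_def by blast
  qed (use P \<open>P g\<close> assms slit_plane_open slit_plane_connected in \<open>auto simp: P_def\<close>)
  then show ?thesis by (simp add: g_def)
qed

text \<open>On the negative axis the base 1 + x s^2 is a positive real, where the principal complex
  power is the real one.\<close>

lemma gauss_hypergeometric_quarter_neg:
  fixes x :: real
  assumes "x \<ge> 0"
  shows "gauss_hypergeometric (1/2) (1/4) (3/2) (of_real (- x)) =
    of_real (integral {0..1} (\<lambda>s. (1 + x * s\<^sup>2) powr (- 1/4)))"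
proof -
  have "complex_of_real (- x) \<in> slit_plane"
    using assms by auto
  moreover have "integral {0..1} (\<lambda>s. (1 - complex_of_real (- x) * of_real (s\<^sup>2)) powr (- (1/4)))
     = integral {0..1} (\<lambda>s. complex_of_real ((1 + x * s\<^sup>2) powr (- 1/4)))"
  proof (rule integral_cong)
    fix s :: real
    have "1 + x * s\<^sup>2 > 0" using assms by (simp add: add_pos_nonneg)
    then show "(1 - complex_of_real (- x) * of_real (s\<^sup>2)) powr (- (1/4)) =
        of_real ((1 + x * s\<^sup>2) powr (- 1/4))"
      using powr_of_real[of "1 + x * s\<^sup>2" "-1/4"] by simp
  qed
  moreover have "(\<lambda>s. (1 + x * s\<^sup>2) powr (- 1/4)) integrable_on {0..1}"
  proof (intro integrable_continuous_real continuous_intros)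
    show "\<forall>s\<in>{0..1}. 1 + x * s\<^sup>2 \<noteq> 0"
      using assms by (metis add_pos_nonneg less_irrefl mult_nonneg_nonneg zero_le_power2 zero_less_one)
  qed
  from integral_linear[OF this bounded_linear_of_real]
  have "integral {0..1} (\<lambda>s. complex_of_real ((1 + x * s\<^sup>2) powr (- 1/4))) =
      of_real (integral {0..1} (\<lambda>s. (1 + x * s\<^sup>2) powr (- 1/4)))"
    by (simp add: o_def)
  ultimately show ?thesis
    using gauss_hypergeometric_half[of "of_real (- x)" "1/4"] by simp
qed

section \<open>The distance\<close>

lemma EH_radial_antiderivative:
  assumes "t > 0"
  obtains G where "\<And>x. (G has_real_derivative EH_radial_speed t K x) (at x)"
proof -
  have pos: "(x * K)\<^sup>2 + t ^ 4 > 0" for x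
    using assms by (simp add: add_nonneg_pos)
  have "isCont (EH_radial_speed t K) x" for x
    unfolding EH_radial_speed_def using pos[of x]
    by (intro continuous_intros) auto
  then have "\<exists>G. \<forall>x::real. - \<infinity> < ereal x \<longrightarrow> ereal x < \<infinity> \<longrightarrow>
      (G has_vector_derivative EH_radial_speed t K x) (at x)"
    by (intro einterval_antiderivative) auto
  then show thesis
    using that by (auto simp: has_real_derivative_iff_has_vector_derivative)
qed

text \<open>Taking t^4 out of the nested roots leaves a fourth root. This is the origin of the
  factor 1 / (t sqrt 2) and of the parameter 1/4.\<close>

lemma EH_radial_speed_powr:
  assumes "t > 0"
  shows "EH_radial_speed t K x = K / (t * sqrt 2) * (1 + (x * K)\<^sup>2 / t ^ 4) powr (- 1/4)"
proof -
  define B where "B = 1 + (x * K)\<^sup>2 / t ^ 4"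
  have B: "B > 0" unfolding B_def using assms by (intro add_pos_nonneg) auto
  have "(x * K)\<^sup>2 + t ^ 4 = t ^ 4 * B"
    using assms by (simp add: B_def field_simps)
  moreover have "sqrt (t ^ 4) = t\<^sup>2"
    by (rule real_sqrt_unique) (simp_all flip: power_mult)
  ultimately have "sqrt (2 * sqrt ((x * K)\<^sup>2 + t ^ 4)) = sqrt 2 * t * sqrt (sqrt B)"
    using assms by (simp add: real_sqrt_mult)
  moreover have "sqrt (sqrt B) = B powr (1/4)"
    using B by (simp add: powr_half_sqrt[symmetric] powr_powr)
  ultimately have "EH_radial_speed t K x = K / (sqrt 2 * t * B powr (1/4))"
    by (simp only: EH_radial_speed_def)
  also have "\<dots> = K / (t * sqrt 2) * (1 / B powr (1/4))"
    by simp
  also have "1 / B powr (1/4) = B powr (- 1/4)"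
    using powr_minus_divide[of B "1/4"] by simp
  finally show ?thesis unfolding B_def .
qed

text \<open>Rescaling the interval from 0 to \<open>x\<close> to the unit interval turns the
  argument of the density into x s, so Euler's integral appears at the point -y.\<close>

lemma EH_radial_distance:
  assumes t: "t > 0" and x: "x \<ge> 0"
    and G: "\<And>x. (G has_real_derivative EH_radial_speed t K x) (at x)"
  shows "complex_of_real (G x - G 0) = complex_of_real (1 / (t * sqrt 2) * x * K) *
    gauss_hypergeometric (1/2) (1/4) (3/2) (complex_of_real (- (x\<^sup>2 * K\<^sup>2 / t ^ 4)))"
proof -
  define y where "y = x\<^sup>2 * K\<^sup>2 / t ^ 4"
  have y: "y \<ge> 0" using t by (simp add: y_def)
  have "((\<lambda>s. x * EH_radial_speed t K (x * s)) has_integral (G (x * 1) - G (x * 0))) {0..1}"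
  proof (rule fundamental_theorem_of_calculus)
    fix s :: real
    have "((\<lambda>s. x * s) has_real_derivative x) (at s within {0..1})"
      by (auto intro!: derivative_eq_intros)
    from DERIV_chain2[OF G this]
    show "((\<lambda>s. G (x * s)) has_vector_derivative x * EH_radial_speed t K (x * s)) (at s within {0..1})"
      by (simp add: has_real_derivative_iff_has_vector_derivative mult.commute)
  qed simp
  then have "G x - G 0 = integral {0..1} (\<lambda>s. x * EH_radial_speed t K (x * s))"
    by (simp add: integral_unique del: integral_mult_right)
  also have "(\<lambda>s. x * EH_radial_speed t K (x * s)) =
      (\<lambda>s. 1 / (t * sqrt 2) * x * K * (1 + y * s\<^sup>2) powr (- 1/4))"
    unfolding EH_radial_speed_powr[OF t] y_def by (simp add: power_mult_distrib fun_eq_iff mult_ac)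
  also have "integral {0..1} \<dots> =
      1 / (t * sqrt 2) * x * K * integral {0..1} (\<lambda>s. (1 + y * s\<^sup>2) powr (- 1/4))"
    by (rule integral_mult_right)
  finally show ?thesis
    unfolding gauss_hypergeometric_quarter_neg[OF y, unfolded y_def] y_def by (simp only: of_real_mult)
qed

text \<open>The bounds are asymmetric: the lower one holds for every end point over the circle, the
  upper one for the end point in the fibre of \<open>p\<close>. That is enough for an infimum over
  the zero curve.\<close>

lemma EH_dist_radial:
  assumes t: "t > 0" and p: "cmod (p $ 1) = r" "p $ 2 \<noteq> 0"
    and G: "\<And>x. (G has_real_derivative EH_radial_speed t (1 + r\<^sup>2) x) (at x)"
  shows EH_dist_in_ge: "cmod w = r \<Longrightarrow>
      G (cmod (p $ 2)) - G 0 \<le> EH_dist_in t (EH_M3 (sphere 0 r)) (EH_param0 p) (EH_class w 1 0)"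
    and EH_dist_in_le: "EH_dist_in t (EH_M3 (sphere 0 r)) (EH_param0 p) (EH_class (p $ 1) 1 0)
      \<le> G (cmod (p $ 2)) - G 0"
proof -
  define Ls where "Ls = (\<lambda>w. {EH_length t \<sigma> | \<sigma>. EH_piecewise_C1_curve \<sigma> \<and>
    \<sigma> ` {0..1} \<subseteq> EH_M3 (sphere 0 r) \<and> \<sigma> 0 = EH_param0 p \<and> \<sigma> 1 = EH_class w 1 0})"
  have dist: "EH_dist_in t (EH_M3 (sphere 0 r)) (EH_param0 p) (EH_class w 1 0) = Inf (Ls w)" for w
    unfolding EH_dist_in_def Ls_def ..
  have ge: "G (cmod (p $ 2)) - G 0 \<le> l" if "l \<in> Ls w" for l w
  proof -
    have "EH_class w 1 0 = EH_param0 (vector [w, 0])" by (simp add: EH_param0_def)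
    then show ?thesis
      using that EH_length_ge[OF t _ _ _ p(2) _ _ G] unfolding Ls_def by fastforce
  qed
  have mem: "EH_length t (EH_radial_curve p \<theta>) \<in> Ls (p $ 1 * cis \<theta>)" for \<theta>
    unfolding Ls_def
  proof (intro CollectI exI conjI refl)
    show "EH_radial_curve p \<theta> ` {0..1} \<subseteq> EH_M3 (sphere 0 r)"
      using EH_radial_curve_M3[of p \<theta>] p by auto
    show "EH_radial_curve p \<theta> 1 = EH_class (p $ 1 * cis \<theta>) 1 0"
      by (simp add: EH_radial_curve_ends EH_param0_def)
  qed (simp_all add: EH_radial_curve_C1 EH_radial_curve_ends)
  show "G (cmod (p $ 2)) - G 0 \<le> EH_dist_in t (EH_M3 (sphere 0 r)) (EH_param0 p) (EH_class w 1 0)"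
    if w: "cmod w = r"
  proof -
    \<comment> \<open>Points of equal modulus differ by a rotation, so some radial curve ends at
      \<open>w\<close> and the set of lengths is nonempty; for radius 0 both points are the
      origin.\<close>
    obtain \<theta> where "w = p $ 1 * cis \<theta>"
    proof (cases "r = 0")
      case False
      then have "w / p $ 1 = cis (Arg (w / p $ 1))"
        using w p by (subst cis_Arg) (auto simp: sgn_eq norm_divide)
      then show thesis using that False p by (metis nonzero_eq_divide_eq mult.commute norm_zero)
    qed (use w p that in auto)
    then have "Ls w \<noteq> {}" using mem by blast
    then show ?thesis
      unfolding dist using ge by (rule cInf_greatest)
  qed
  have "EH_length t (EH_radial_curve p 0) \<in> Ls (p $ 1)"
    using mem[of 0] by simp
  \<comment> \<open>An infimum lies below the members of its set only if the set is bounded below;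
    \<open>ge\<close> supplies the bound.\<close>
  then have "Inf (Ls (p $ 1)) \<le> EH_length t (EH_radial_curve p 0)"
    using ge by (intro cInf_lower bdd_belowI) auto
  then show "EH_dist_in t (EH_M3 (sphere 0 r)) (EH_param0 p) (EH_class (p $ 1) 1 0)
      \<le> G (cmod (p $ 2)) - G 0"
    unfolding dist using EH_radial_length[OF t, of G p] G p by simp
qed

theorem proposition10:
  fixes t r\<^sub>0 s\<^sub>0 \<rho>\<^sub>0 \<phi>\<^sub>0 :: real
    and I :: "real set"
    and r \<phi>\<^sub>\<Gamma> :: "real \<Rightarrow> real"
    and \<Gamma> :: "real \<Rightarrow> complex"
  assumes "t > 0"
    and "r\<^sub>0 > 0"
    and "is_interval I"
    and "\<And>s. s \<in> I \<Longrightarrow> \<Gamma> s = of_real (r s) * cis (\<phi>\<^sub>\<Gamma> s)"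
    and "arc_length_param_on \<Gamma> I"
    and "\<And>s. s \<in> I \<Longrightarrow> r s = r\<^sub>0"
    and "\<Gamma> ` I = sphere 0 r\<^sub>0"
    and "s\<^sub>0 \<in> I" and "\<rho>\<^sub>0 > 0"
  shows "complex_of_real
           (EH_setdist_in t (EH_M3 (\<Gamma> ` I)) (EH_Psi \<Gamma> s\<^sub>0 \<rho>\<^sub>0 \<phi>\<^sub>0) (EH_zero_curve (\<Gamma> ` I))) =
         complex_of_real (1 / (t * sqrt 2) * \<rho>\<^sub>0\<^sup>2 * (r\<^sub>0\<^sup>2 + 1)) *
           gauss_hypergeometric (1/2) (1/4) (3/2)
             (complex_of_real (- (\<rho>\<^sub>0^4 * (r\<^sub>0\<^sup>2 + 1)\<^sup>2 / t^4)))"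
proof -
  \<comment> \<open>In the chart the fibre coordinate is the square of \<rho> e^(i \<phi>), so its
    modulus is the square of \<open>\<rho>\<^sub>0\<close>; hence the second and fourth powers in
    the formula.\<close>
  define p :: "complex ^ 2" where "p = vector [\<Gamma> s\<^sub>0, (of_real \<rho>\<^sub>0 * cis \<phi>\<^sub>0)\<^sup>2]"
  have "\<Gamma> s\<^sub>0 \<in> sphere 0 r\<^sub>0" using assms(7,8) by blast
  then have p: "cmod (p $ 1) = r\<^sub>0" "p $ 2 \<noteq> 0" "cmod (p $ 2) = \<rho>\<^sub>0\<^sup>2"
    using \<open>\<rho>\<^sub>0 > 0\<close> by (simp_all add: p_def norm_mult norm_power)
  have Psi: "EH_Psi \<Gamma> s\<^sub>0 \<rho>\<^sub>0 \<phi>\<^sub>0 = EH_param0 p"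
    using EH_Psi_eq[OF \<open>\<rho>\<^sub>0 > 0\<close>] by (simp add: p_def EH_param0_def)
  obtain G where G: "\<And>x. (G has_real_derivative EH_radial_speed t (1 + r\<^sub>0\<^sup>2) x) (at x)"
    using EH_radial_antiderivative[OF \<open>t > 0\<close>] by blast
  note ge = EH_dist_in_ge[OF \<open>t > 0\<close> p(1,2) G] and le = EH_dist_in_le[OF \<open>t > 0\<close> p(1,2) G]
  \<comment> \<open>The nearest point of the zero curve is the one in the fibre of \<open>p\<close>;
    all others obey the same lower bound.\<close>
  have "EH_setdist_in t (EH_M3 (sphere 0 r\<^sub>0)) (EH_param0 p) (EH_zero_curve (sphere 0 r\<^sub>0)) =
      G (\<rho>\<^sub>0\<^sup>2) - G 0"
    unfolding EH_setdist_in_def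
  proof (rule antisym)
    have mem: "EH_class (p $ 1) 1 0 \<in> EH_zero_curve (sphere 0 r\<^sub>0)"
      using p by (auto simp: EH_zero_curve_def)
    have "bdd_below ((\<lambda>y. EH_dist_in t (EH_M3 (sphere 0 r\<^sub>0)) (EH_param0 p) y) `
        EH_zero_curve (sphere 0 r\<^sub>0))"
      using ge by (intro bdd_belowI2) (auto simp: EH_zero_curve_def)
    then have "(INF y\<in>EH_zero_curve (sphere 0 r\<^sub>0).
        EH_dist_in t (EH_M3 (sphere 0 r\<^sub>0)) (EH_param0 p) y) \<le>
        EH_dist_in t (EH_M3 (sphere 0 r\<^sub>0)) (EH_param0 p) (EH_class (p $ 1) 1 0)"
      using mem by (rule cINF_lower)
    then show "(INF y\<in>EH_zero_curve (sphere 0 r\<^sub>0).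
        EH_dist_in t (EH_M3 (sphere 0 r\<^sub>0)) (EH_param0 p) y) \<le> G (\<rho>\<^sub>0\<^sup>2) - G 0"
      using le p(3) by simp
    show "G (\<rho>\<^sub>0\<^sup>2) - G 0 \<le> (INF y\<in>EH_zero_curve (sphere 0 r\<^sub>0).
        EH_dist_in t (EH_M3 (sphere 0 r\<^sub>0)) (EH_param0 p) y)"
      using ge p(3) mem by (intro cINF_greatest) (auto simp: EH_zero_curve_def)
  qed
  then show ?thesis
    using EH_radial_distance[OF \<open>t > 0\<close> _ G, of "\<rho>\<^sub>0\<^sup>2"]
    unfolding assms(7) Psi by (simp add: add.commute[of 1])
qed

end
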